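(* Every affine Coxeter group of type $\widetilde A$, $\widetilde C$, or $\widetilde G_2$ is futuristic.
   Context: Let $(W,S)$ be a Coxeter system with $S=\{s_i:i\in I\}$, $I$ a finite index set; $m(i,i')$ is the order of $s_is_{i'}$. The Coxeter graph $\Gamma_W$ has vertex set $I$, with distinct $i,i'$ joined by an edge labeled $m(i,i')$ whenever $m(i,i')\ge 3$ (label $3$ is omitted in drawings). Types: $\widetilde A_1$ has two vertices joined by an edge labeled $\infty$; $\widetilde A_{n-1}$ ($n\ge 3$) has as Coxeter graph the $n$-vertex cycle with all labels $3$; $\widetilde C_{n-1}$ ($n\ge 3$) has as Coxeter graph the $n$-vertex path whose first and last edges are labeled $4$ and whose other edges are labeled $3$; $\widetilde G_2$ has as Coxeter graph the $3$-vertex path with edge labels $3$ and $6$. The root space is $V=\mathbb R^I$ with standard basis the simple roots $\{\alpha_i:i\in I\}$ and symmetric bilinear form $B(\alpha_i,\alpha_{i'})=-\cos(\pi/m(i,i'))$ (and $-1$ if $m(i,i')=\infty$). $W$ acts on $V$ by $s_i\beta=\beta-2B(\beta,\alpha_i)\alpha_i$. The root system is $\Phi=\{w\alpha_i:w\in W,i\in I\}=\Phi^+\sqcup\Phi^-$, where $\Phi^+$ are the roots that are nonnegative combinations of simple roots and $\Phi^-=-\Phi^+$. For $\beta\in\Phi$ the half-space $H_\beta^+$ is $\{w\in W:w\beta\in\Phi^+\}$. A subset of $W$ is convex if it is an intersection of half-spaces (the empty intersection being $W$). For a nonempty convex set $\mathscr L\subseteq W$ let $\mathrm R(\mathscr L)=\{\beta\in\Phi:\mathscr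 L\subseteq H_\beta^+\}$. For $i\in I$, the toggle $\tau_i\colon W\to W$ is defined by $\tau_i(u)=u$ if $u^{-1}\alpha_i\in\mathrm R(\mathscr L)$ and $\tau_i(u)=s_iu$ otherwise. A Coxeter element is a product $c=s_{i_n}\cdots s_{i_1}$ where $i_1,\ldots,i_n$ is an ordering of $I$ (each element once); $\mathrm{Pro}_c=\tau_{i_n}\cdots\tau_{i_1}$ (composition), which depends only on $c$ and $\mathscr L$. The set $\mathscr L$ is heavy with respect to $c$ if every periodic point of $\mathrm{Pro}_c$ (i.e. every $u\in W$ with $\mathrm{Pro}_c^K(u)=u$ for some $K\ge 1$) lies in $\mathscr L$. The Coxeter group $W$ is futuristic if every nonempty convex subset of $W$ is heavy with respect to every Coxeter element of $W$. *)

theory Defs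
  imports "HOL-Algebra.Generated_Groups"
    "HOL-Algebra.Multiplicative_Group" "HOL-Analysis.Analysis" "HOL-Library.Extended_Nat"
begin

text \<open>The index set of the simple reflections is the finite type \<open>'i\<close>, so that the root space
  is \<open>real ^ 'i\<close>.\<close>

locale indexed_group = group W for W (structure) +
  fixes s :: "'i::finite \<Rightarrow> 'a"
  assumes s_closed: "s i \<in> carrier W"
begin

text \<open>The library's \<open>ord x\<close> is \<open>0\<close> when \<open>x\<close> has infinite order.\<close>

definition m :: "'i \<Rightarrow> 'i \<Rightarrow> enat" where
  "m i j = (if ord (s i \<otimes> s j) = 0 then \<infinity> else enat (ord (s i \<otimes> s j)))"

definition word_prod :: "'i list \<Rightarrow> 'a" where
  "word_prod is = foldr (\<lambda>i g. s i \<otimes> g) is \<one>"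

text \<open>The congruence on words generated by \<open>(s\<^sub>i s\<^sub>j)\<^bsup>m(i,j)\<^esup> = 1\<close> for all
  \<open>i, j\<close> with \<open>m(i,j) < \<infinity>\<close>. If \<open>s\<^sub>i\<close> is an involution then \<open>m(i,i) = 1\<close>, so the relation
  \<open>s\<^sub>i\<^sup>2 = 1\<close> is included, and words without formal inverses suffice.\<close>

inductive coxeter_equiv :: "'i list \<Rightarrow> 'i list \<Rightarrow> bool" where
  relation: "m i j = enat k \<Longrightarrow> coxeter_equiv (us @ concat (replicate k [i, j]) @ vs) (us @ vs)"
| refl: "coxeter_equiv us us"
| sym: "coxeter_equiv us vs \<Longrightarrow> coxeter_equiv vs us"
| trans: "coxeter_equiv us vs \<Longrightarrow> coxeter_equiv vs ws \<Longrightarrow> coxeter_equiv us ws"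

end

text \<open>The last two assumptions say that \<open>\<langle>s\<^sub>i | (s\<^sub>i s\<^sub>j)\<^bsup>m(i,j)\<^esup> = 1\<rangle>\<close> is a presentation of \<open>W\<close>.\<close>

locale coxeter_system = indexed_group W s for W (structure) and s :: "'i::finite \<Rightarrow> 'a" +
  assumes inj_s: "inj s"
    and ord_s: "ord (s i) = 2"
    and generate_s: "generate W (range s) = carrier W"
    and presentation: "word_prod us = word_prod vs \<longleftrightarrow> coxeter_equiv us vs"
begin

text \<open>The set of labeled edges; the vertex set is all of \<open>'i\<close>.\<close>

definition coxeter_graph :: "('i set \<times> enat) set" where
  "coxeter_graph = {({i, j}, m i j) | i j. i \<noteq> j \<and> m i j \<ge> 3}"

definition simple_root :: "'i \<Rightarrow> real ^ 'i" where
  "simple_root i = axis i 1"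

definition B_simple :: "'i \<Rightarrow> 'i \<Rightarrow> real" where
  "B_simple i j = (case m i j of enat k \<Rightarrow> - cos (pi / real k) | \<infinity> \<Rightarrow> - 1)"

definition B :: "real ^ 'i \<Rightarrow> real ^ 'i \<Rightarrow> real" where
  "B \<beta> \<gamma> = (\<Sum>i\<in>UNIV. \<Sum>j\<in>UNIV. \<beta> $ i * \<gamma> $ j * B_simple i j)"

definition simple_reflection :: "'i \<Rightarrow> real ^ 'i \<Rightarrow> real ^ 'i" where
  "simple_reflection i \<beta> = \<beta> - (2 * B \<beta> (simple_root i)) *\<^sub>R simple_root i"

text \<open>The simple reflections satisfy the defining relations of \<open>W\<close>, hence the vector described
  here does not depend on the word \<open>is\<close> chosen to represent \<open>w\<close>.\<close>

definition act :: "'a \<Rightarrow> real ^ 'i \<Rightarrow> real ^ 'i" where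
  "act w \<beta> = (THE \<gamma>. \<exists>is. word_prod is = w \<and> \<gamma> = foldr simple_reflection is \<beta>)"

definition roots :: "(real ^ 'i) set" where
  "roots = {act w (simple_root i) | w i. w \<in> carrier W}"

definition positive_roots :: "(real ^ 'i) set" where
  "positive_roots = {\<beta> \<in> roots. \<forall>i. \<beta> $ i \<ge> 0}"

definition half_space :: "real ^ 'i \<Rightarrow> 'a set" where
  "half_space \<beta> = {w \<in> carrier W. act w \<beta> \<in> positive_roots}"

definition convex_subset :: "'a set \<Rightarrow> bool" where
  "convex_subset L \<longleftrightarrow> (\<exists>A \<subseteq> roots. L = carrier W \<inter> (\<Inter>\<beta>\<in>A. half_space \<beta>))"

definition R :: "'a set \<Rightarrow> (real ^ 'i) set" where
  "R L = {\<beta> \<in> roots. L \<subseteq> half_space \<beta>}"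

definition toggle :: "'a set \<Rightarrow> 'i \<Rightarrow> 'a \<Rightarrow> 'a" where
  "toggle L i u = (if act (inv u) (simple_root i) \<in> R L then u else s i \<otimes> u)"

text \<open>The list \<open>is = [i\<^sub>1, \<dots>, i\<^sub>n]\<close> is an ordering of the index set such that
  \<open>c = s\<^bsub>i\<^sub>n\<^esub> \<cdots> s\<^bsub>i\<^sub>1\<^esub>\<close>.\<close>

definition ordering_for :: "'a \<Rightarrow> 'i list \<Rightarrow> bool" where
  "ordering_for c is \<longleftrightarrow> distinct is \<and> set is = UNIV \<and> c = word_prod (rev is)"

definition coxeter_element :: "'a \<Rightarrow> bool" where
  "coxeter_element c \<longleftrightarrow> (\<exists>is. ordering_for c is)"

text \<open>\<open>promotion L [i\<^sub>1, \<dots>, i\<^sub>n]\<close> applies the toggle at \<open>i\<^sub>1\<close> first.\<close>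

definition promotion :: "'a set \<Rightarrow> 'i list \<Rightarrow> 'a \<Rightarrow> 'a" where
  "promotion L is = fold (toggle L) is"

text \<open>All orderings that yield the Coxeter element \<open>c\<close> define the same promotion operator
  \<open>Pro\<^sub>c\<close>; quantifying over all of them avoids having to single one out.\<close>

definition heavy :: "'a set \<Rightarrow> 'a \<Rightarrow> bool" where
  "heavy L c \<longleftrightarrow> (\<forall>is. ordering_for c is \<longrightarrow>
     (\<forall>u \<in> carrier W. (\<exists>K \<ge> 1. (promotion L is ^^ K) u = u) \<longrightarrow> u \<in> L))"

definition futuristic :: bool where
  "futuristic \<longleftrightarrow>
     (\<forall>L c. convex_subset L \<and> L \<noteq> {} \<and> coxeter_element c \<longrightarrow> heavy L c)"

text \<open>In each type, \<open>v\<close> numbers the vertices of the Coxeter graph as \<open>v 0, \<dots>, v (n - 1)\<close>.\<close>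

definition type_A_tilde :: bool where
  "type_A_tilde \<longleftrightarrow>
     (\<exists>v. bij_betw v {..<2::nat} UNIV \<and> coxeter_graph = {({v 0, v 1}, \<infinity>)}) \<or>
     (\<exists>n\<ge>3. \<exists>v. bij_betw v {..<n::nat} UNIV \<and>
        coxeter_graph = {({v k, v (Suc k mod n)}, 3) | k. k < n})"

definition type_C_tilde :: bool where
  "type_C_tilde \<longleftrightarrow>
     (\<exists>n\<ge>3. \<exists>v. bij_betw v {..<n::nat} UNIV \<and>
        coxeter_graph =
          {({v k, v (Suc k)}, if k = 0 \<or> k = n - 2 then 4 else 3) | k. Suc k < n})"

definition type_G2_tilde :: bool where
  "type_G2_tilde \<longleftrightarrow>
     (\<exists>v. bij_betw v {..<3::nat} UNIV \<and>
        coxeter_graph = {({v 0, v 1}, 3), ({v 1, v 2}, 6)})"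

end

end

theory Submission
  imports Defs
begin

text \<open>In types \<open>A\<close> and \<open>C\<close> the group acts on \<open>\<int>\<close>, node \<open>i\<close> swapping all pairs of adjacent
  positions \<open>{k, k + 1}\<close> that lie over \<open>i\<close>, and the roots are the positive multiples of \<open>P b - P a\<close>
  for labels \<open>a \<noteq> b\<close>. Toggling becomes sorting: neighbours \<open>a, b\<close> in this order are exchanged unless
  every element of the convex set has \<open>a\<close> before \<open>b\<close>. Each position carries a stone that moves to
  the right or to the left. Suppose that some pair stays in the wrong order along a periodic orbit.
  Approaching stones carrying such a pair would meet, which would sort the pair, and a label that
  sits on stones of one direction forever is carried arbitrarily far, against periodicity.
  In type \<open>G\<^sub>2\<close> one follows the roots of \<open>R L\<close> made negative by the periodic point. If
  such a root exists, the walls of all of them must be parallel to the glide axis of the Coxeter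
  element, and then no toggle ever fixes the point, which therefore drifts away along that axis.\<close>

text \<open>A toggle may repair a violated inequality, i.e. a root of \<open>R L\<close> that the
  point makes negative, but never creates one: the step that would do so is exactly the step that is
  refused. On a periodic orbit the set of violated inequalities is therefore constant. The obstacle
  is that a refused step does not move the point at all, so a fixed violated pair or root may stand
  still. Both arguments follow a carrier that goes on moving. In types A and C this is the stone:
  after a refusal it continues with another label, further along the order, and transitivity keeps
  the pair violated. In type \<open>G\<^sub>2\<close> a refused reflection is applied to the root
  instead of the point; if its pairing with the simple root has the right sign, the new root is a
  nonnegative combination of elements of \<open>R L\<close> and hence violated too. It then suffices
  to exclude unbounded motion.\<close>

section \<open>Sorting labels carried by stones on the integers\<close>

text \<open>\<open>u t a\<close> is the position of label \<open>a\<close> at time \<open>t\<close>,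
  and \<open>T t\<close> holds the left ends of the pairs toggled at time \<open>t\<close>.
  \<open>D t k\<close> means that the stone at \<open>k\<close> travels to the right. By
  \<open>D_toggle\<close> the stones of a toggled pair face each other and pass, even if the labels
  stay; it also makes simultaneously toggled pairs disjoint.\<close>

locale stones =
  fixes u :: "nat \<Rightarrow> int \<Rightarrow> int" and T :: "nat \<Rightarrow> int set" and D :: "nat \<Rightarrow> int \<Rightarrow> bool"
    and prec :: "int \<Rightarrow> int \<Rightarrow> bool" (infix "\<triangleleft>" 50) and period :: nat
  assumes bij_u: "bij (u t)"
    and stay: "\<lbrakk>u t a = k; u t b = k + 1; k \<in> T t; a \<triangleleft> b\<rbrakk> \<Longrightarrow> u (Suc t) a = k \<and> u (Suc t) b = k + 1"
    and cross: "\<lbrakk>u t a = k; u t b = k + 1; k \<in> T t; \<not> a \<triangleleft> b\<rbrakk> \<Longrightarrow> u (Suc t) a = k + 1 \<and> u (Suc t) b = k"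
    and idle: "\<lbrakk>u t a \<notin> T t; u t a - 1 \<notin> T t\<rbrakk> \<Longrightarrow> u (Suc t) a = u t a"
    and D_toggle: "k \<in> T t \<Longrightarrow> D t k \<and> \<not> D t (k + 1) \<and> \<not> D (Suc t) k \<and> D (Suc t) (k + 1)"
    and D_idle: "\<lbrakk>k \<notin> T t; k - 1 \<notin> T t\<rbrakk> \<Longrightarrow> D (Suc t) k = D t k"
    and recurrent: "\<exists>t'\<ge>t. k \<in> T t'"
    and prec_trans: "\<lbrakk>a \<triangleleft> b; b \<triangleleft> d\<rbrakk> \<Longrightarrow> a \<triangleleft> d"
    and prec_irrefl: "\<not> a \<triangleleft> a"
    and period_pos: "period > 0"
    and periodic: "u (t + period) = u t"
begin

lemma periodic_mult: "u (t + j * period) = u t"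
proof (induction j)
  case (Suc j)
  then show ?case using periodic[of "t + j * period"] by (simp add: algebra_simps)
qed simp

lemma at_label: obtains b where "u t b = k"
  using bij_u[of t] by (metis bij_pointE)

lemma ordered_Suc:
  assumes "a \<triangleleft> b" "u t a < u t b"
  shows "u (Suc t) a < u (Suc t) b"
proof -
  have step: "u (Suc t) d = u t d \<or> u (Suc t) d = u t d + 1 \<and> u t d \<in> T t \<or>
      u (Suc t) d = u t d - 1 \<and> u t d - 1 \<in> T t" for d
  proof -
    consider "u t d \<in> T t" | "u t d - 1 \<in> T t" | "u t d \<notin> T t" "u t d - 1 \<notin> T t" by blast
    then show ?thesis
    proof cases
      case 1
      obtain y where "u t y = u t d + 1" by (rule at_label)
      then show ?thesis using stay[of t d "u t d" y] cross[of t d "u t d" y] 1 by blast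
    next
      case 2
      obtain y where "u t y = u t d - 1" by (rule at_label)
      then show ?thesis using stay[of t y "u t d - 1" d] cross[of t y "u t d - 1" d] 2 by auto
    qed (use idle in blast)
  qed
  show ?thesis
  proof (cases "u t b = u t a + 1 \<and> u t a \<in> T t")
    case True
    then show ?thesis using stay[of t a "u t a" b] assms by auto
  next
    case False
    \<comment> \<open>Disjointness of toggled pairs: labels at distance two cannot both move into
      the gap.\<close>
    have "u t a + 1 \<notin> T t" if "u t a \<in> T t" using D_toggle that by blast
    then show ?thesis using step[of a] step[of b] assms(2) False
      by (smt (verit, ccfv_SIG) diff_add_cancel)
  qed
qed

lemma ordered_later:
  assumes "a \<triangleleft> b" "u t a < u t b"
  shows "u (t + j) a < u (t + j) b"
  using assms by (induction j) (auto intro: ordered_Suc)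

definition inverted :: "nat \<Rightarrow> int \<Rightarrow> int \<Rightarrow> bool" where
  "inverted t a b \<longleftrightarrow> a \<triangleleft> b \<and> u t b < u t a"

text \<open>A sorted pair stays sorted, so it would still be sorted one period after
  \<open>t\<close>, when the arrangement of time \<open>t\<close> recurs.\<close>

lemma inverted_Suc:
  assumes "inverted t a b" shows "\<not> u (Suc t) a < u (Suc t) b"
proof
  assume "u (Suc t) a < u (Suc t) b"
  then have "u (Suc t + (period - 1)) a < u (Suc t + (period - 1)) b"
    using assms ordered_later unfolding inverted_def by blast
  then show False using assms periodic[of t] period_pos unfolding inverted_def by simp
qed

text \<open>The stone is followed, not the label. If the toggle leaves the labels in place, the
  stone takes over the label of its right neighbour, which is larger. So labels increase along a
  right-moving stone and, dually, decrease along a left-moving one.\<close>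

lemma right_stone:
  assumes "D t (u t b)"
  shows "\<exists>b'. (b' = b \<or> b \<triangleleft> b') \<and> D (Suc t) (u (Suc t) b') \<and>
    u (Suc t) b' = u t b + (if u t b \<in> T t then 1 else 0)"
proof (cases "u t b \<in> T t")
  case True
  obtain y where y: "u t y = u t b + 1" by (rule at_label)
  show ?thesis
    using stay[of t b "u t b" y] cross[of t b "u t b" y] y True D_toggle[OF True]
    by (cases "b \<triangleleft> y") auto
next
  case False
  moreover have "u t b - 1 \<notin> T t" using D_toggle[of "u t b - 1" t] assms by auto
  ultimately show ?thesis using idle D_idle assms by auto
qed

lemma left_stone:
  assumes "\<not> D t (u t a)"
  shows "\<exists>a'. (a' = a \<or> a' \<triangleleft> a) \<and> \<not> D (Suc t) (u (Suc t) a') \<and>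
    u (Suc t) a' = u t a - (if u t a - 1 \<in> T t then 1 else 0)"
proof (cases "u t a - 1 \<in> T t")
  case True
  obtain y where y: "u t y = u t a - 1" by (rule at_label)
  show ?thesis
    using stay[of t y "u t a - 1" a] cross[of t y "u t a - 1" a] y True D_toggle[OF True]
    by (cases "y \<triangleleft> a") auto
next
  case False
  moreover have "u t a \<notin> T t" using D_toggle[of "u t a" t] assms by auto
  ultimately show ?thesis using idle D_idle assms by auto
qed

lemma approaching_Suc:
  assumes "inverted t a b" "D t (u t b)" "\<not> D t (u t a)"
  shows "\<exists>a' b'. inverted (Suc t) a' b' \<and> D (Suc t) (u (Suc t) b') \<and> \<not> D (Suc t) (u (Suc t) a') \<and>
    u (Suc t) b' \<ge> u t b \<and> (u t b \<in> T t \<longrightarrow> u (Suc t) b' > u t b) \<and> u (Suc t) a' \<le> u t a"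
proof -
  obtain b' where b': "b' = b \<or> b \<triangleleft> b'" "D (Suc t) (u (Suc t) b')"
      "u (Suc t) b' = u t b + (if u t b \<in> T t then 1 else 0)"
    using right_stone[OF assms(2)] by blast
  obtain a' where a': "a' = a \<or> a' \<triangleleft> a" "\<not> D (Suc t) (u (Suc t) a')"
      "u (Suc t) a' = u t a - (if u t a - 1 \<in> T t then 1 else 0)"
    using left_stone[OF assms(3)] by blast
  have ab: "a \<triangleleft> b" "u t b < u t a" using assms(1) unfolding inverted_def by auto
  have prec: "a' \<triangleleft> b'" using a'(1) b'(1) ab(1) prec_trans by blast
  \<comment> \<open>Stones of opposite directions never share a position; this settles stones at
    distance two that both move.\<close>
  have "u (Suc t) b' \<noteq> u (Suc t) a'" using a'(2) b'(2) by auto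
  moreover have "u (Suc t) b' \<le> u (Suc t) a'"
  proof (cases "u t a = u t b + 1")
    case True
    \<comment> \<open>A toggle between adjacent stones would exchange \<open>b\<close> and
      \<open>a\<close> and thereby sort the pair.\<close>
    have "\<not> b \<triangleleft> a" using ab prec_trans prec_irrefl by blast
    then have "u t b \<notin> T t"
      using cross[of t b "u t b" a] True inverted_Suc[OF assms(1)] by auto
    then show ?thesis using a'(3) b'(3) ab True by auto
  next
    case False
    then show ?thesis using a'(3) b'(3) ab by auto
  qed
  ultimately have "inverted (Suc t) a' b'" using prec unfolding inverted_def by auto
  then show ?thesis using a' b' by (intro exI[of _ a'] exI[of _ b']) auto
qed

text \<open>Otherwise the right-moving stone is toggled again and again and passes every bound,
  although it must stay to the left of a stone that started at \<open>u t a\<close> and only moves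
  left.\<close>

lemma not_approaching:
  assumes "inverted t a b" "D t (u t b)" shows "D t (u t a)"
proof (rule ccontr)
  assume notD: "\<not> D t (u t a)"
  define good where "good t' p \<longleftrightarrow> (\<exists>a' b'. inverted t' a' b' \<and> D t' (u t' b') \<and> \<not> D t' (u t' a') \<and>
    p \<le> u t' b' \<and> u t' a' \<le> u t a)" for t' p
  have good_Suc: "good (Suc t') p" if "good t' p" for t' p
    using that approaching_Suc unfolding good_def by (meson order_trans)
  have good_later: "good (t' + j) p" if "good t' p" for t' j p
    using that by (induction j) (auto intro: good_Suc)
  have good_far: "\<exists>t'. good t' (u t b + int j)" for j
  proof (induction j)
    case 0
    then show ?case using assms notD unfolding good_def by auto
  next
    case (Suc j)
    then obtain t0 where t0: "good t0 (u t b + int j)" by blast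
    obtain t1 where t1: "t1 \<ge> t0" "u t b + int j \<in> T t1" using recurrent by blast
    then have "good t1 (u t b + int j)" using good_later[OF t0, of "t1 - t0"] by simp
    then obtain a' b' where ab: "inverted t1 a' b'" "D t1 (u t1 b')" "\<not> D t1 (u t1 a')"
      "u t b + int j \<le> u t1 b'" "u t1 a' \<le> u t a" unfolding good_def by blast
    obtain a'' b'' where "inverted (Suc t1) a'' b''" "D (Suc t1) (u (Suc t1) b'')"
      "\<not> D (Suc t1) (u (Suc t1) a'')" "u (Suc t1) b'' \<ge> u t1 b'"
      "u t1 b' \<in> T t1 \<longrightarrow> u (Suc t1) b'' > u t1 b'" "u (Suc t1) a'' \<le> u t1 a'"
      using approaching_Suc[OF ab(1-3)] by blast
    moreover from this have "u (Suc t1) b'' \<ge> u t b + int (Suc j)"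
      using ab(4) t1(2) by (cases "u t1 b' = u t b + int j") auto
    ultimately have "good (Suc t1) (u t b + int (Suc j))"
      using ab(5) unfolding good_def by (meson order_trans)
    then show ?case by blast
  qed
  obtain t' where "good t' (u t b + int (nat (u t a - u t b)))" using good_far by blast
  then show False using assms(1) unfolding good_def inverted_def by auto
qed

lemma unbounded_imp_False:
  fixes f :: "int \<Rightarrow> int"
  assumes "\<And>t'. t' \<ge> t \<Longrightarrow> f (u t' a) \<le> f (u (Suc t') a)"
    and "\<And>t'. t' \<ge> t \<Longrightarrow> \<exists>t''\<ge>t'. f (u t'' a) < f (u (Suc t'') a)"
  shows False
proof -
  have mono: "f (u t1 a) \<le> f (u (t1 + j) a)" if "t1 \<ge> t" for t1 j
    using assms(1)[of "t1 + _"] that by (induction j) (auto intro: order_trans)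
  obtain t2 where t2: "t2 \<ge> t" "f (u t2 a) < f (u (Suc t2) a)" using assms(2)[of t] by auto
  have "f (u (Suc t2) a) \<le> f (u (Suc t2 + (period - 1)) a)" using mono[of "Suc t2"] t2 by simp
  then show False using t2 periodic[of t2] period_pos by simp
qed

text \<open>A refused toggle would leave \<open>a\<close> on a left-moving stone. So
  \<open>a\<close> advances at every toggle on its right side, and such toggles recur.\<close>

lemma not_right_forever:
  assumes "\<And>t'. t' \<ge> t \<Longrightarrow> D t' (u t' a)" shows False
proof -
  have step: "u (Suc t') a = u t' a + (if u t' a \<in> T t' then 1 else 0)" if "t' \<ge> t" for t'
  proof (cases "u t' a \<in> T t'")
    case True
    obtain y where y: "u t' y = u t' a + 1" by (rule at_label)
    have "D (Suc t') (u (Suc t') a)" using assms that by simp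
    then show ?thesis
      using stay[of t' a "u t' a" y] cross[of t' a "u t' a" y] y True D_toggle[OF True]
      by (cases "a \<triangleleft> y") auto
  next
    case False
    moreover have "u t' a - 1 \<notin> T t'" using D_toggle[of "u t' a - 1" t'] assms[OF that] by auto
    ultimately show ?thesis using idle by auto
  qed
  have "\<exists>t''\<ge>t'. u t'' a < u (Suc t'') a" if "t' \<ge> t" for t'
  proof (rule ccontr)
    assume "\<not> ?thesis"
    then have const: "u (Suc t'') a = u t'' a" if "t'' \<ge> t'" for t''
      using step[of t''] that \<open>t' \<ge> t\<close> by (auto split: if_splits)
    have const': "u (t' + j) a = u t' a" for j by (induction j) (auto simp: const)
    obtain t1 where t1: "t1 \<ge> t'" "u t' a \<in> T t1" using recurrent by blast
    have "u t1 a = u t' a" using const'[of "t1 - t'"] t1(1) by simp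
    then show False using const[of t1] step[of t1] t1 \<open>t' \<ge> t\<close> by auto
  qed
  moreover have "u t' a \<le> u (Suc t') a" if "t' \<ge> t" for t' using step[OF that] by simp
  ultimately show False using unbounded_imp_False[of t "\<lambda>x. x" a] by blast
qed

lemma not_left_forever:
  assumes "\<And>t'. t' \<ge> t \<Longrightarrow> \<not> D t' (u t' a)" shows False
proof -
  have step: "u (Suc t') a = u t' a - (if u t' a - 1 \<in> T t' then 1 else 0)" if "t' \<ge> t" for t'
  proof (cases "u t' a - 1 \<in> T t'")
    case True
    obtain y where y: "u t' y = u t' a - 1" by (rule at_label)
    have "\<not> D (Suc t') (u (Suc t') a)" using assms that by simp
    then show ?thesis
      using stay[of t' y "u t' a - 1" a] cross[of t' y "u t' a - 1" a] y True D_toggle[OF True]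
      by (cases "y \<triangleleft> a") auto
  next
    case False
    moreover have "u t' a \<notin> T t'" using D_toggle[of "u t' a" t'] assms[OF that] by auto
    ultimately show ?thesis using idle by auto
  qed
  have "\<exists>t''\<ge>t'. u t'' a > u (Suc t'') a" if "t' \<ge> t" for t'
  proof (rule ccontr)
    assume "\<not> ?thesis"
    then have const: "u (Suc t'') a = u t'' a" if "t'' \<ge> t'" for t''
      using step[of t''] that \<open>t' \<ge> t\<close> by (auto split: if_splits)
    have const': "u (t' + j) a = u t' a" for j by (induction j) (auto simp: const)
    obtain t1 where t1: "t1 \<ge> t'" "u t' a - 1 \<in> T t1" using recurrent by blast
    have "u t1 a = u t' a" using const'[of "t1 - t'"] t1(1) by simp
    then show False using const[of t1] step[of t1] t1 \<open>t' \<ge> t\<close> by auto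
  qed
  moreover have "u (Suc t') a \<le> u t' a" if "t' \<ge> t" for t' using step[OF that] by simp
  ultimately show False using unbounded_imp_False[of t uminus a] by simp
qed

text \<open>Here \<open>a\<close> is kept and only \<open>b\<close> is replaced along its stone: on
  a right-moving stone \<open>a\<close> never steps back, and the stone behind cannot overtake it.
  The purpose is one label \<open>a\<close> that sits on right-moving stones at all later
  times.\<close>

lemma right_right_Suc:
  assumes "inverted t a b" "D t (u t b)"
  shows "\<exists>b'. inverted (Suc t) a b' \<and> D (Suc t) (u (Suc t) b')"
proof -
  have Da: "D t (u t a)" using not_approaching assms by blast
  obtain b' where b': "b' = b \<or> b \<triangleleft> b'" "D (Suc t) (u (Suc t) b')"
      "u (Suc t) b' = u t b + (if u t b \<in> T t then 1 else 0)"
    using right_stone[OF assms(2)] by blast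
  have "a \<triangleleft> b'" using b'(1) assms(1) prec_trans unfolding inverted_def by blast
  have nT: "u t a - 1 \<notin> T t" using D_toggle[of "u t a - 1" t] Da by auto
  have "u t a \<le> u (Suc t) a"
  proof (cases "u t a \<in> T t")
    case True
    obtain y where y: "u t y = u t a + 1" by (rule at_label)
    then show ?thesis
      using stay[of t a "u t a" y] cross[of t a "u t a" y] True by (cases "a \<triangleleft> y") auto
  qed (use nT idle in auto)
  moreover have "u (Suc t) b' < u t a"
  proof -
    have "u t b < u t a" using assms(1) unfolding inverted_def by auto
    then show ?thesis using b'(3) nT by (cases "u t a = u t b + 1") auto
  qed
  ultimately have "inverted (Suc t) a b'" using \<open>a \<triangleleft> b'\<close> unfolding inverted_def by auto
  then show ?thesis using b'(2) by blast
qed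

lemma inverted_left:
  assumes "inverted t a b" shows "\<not> D t (u t b)"
proof
  assume "D t (u t b)"
  have "\<exists>b'. inverted (t + j) a b' \<and> D (t + j) (u (t + j) b')" for j
    using assms \<open>D t (u t b)\<close> by (induction j) (use right_right_Suc in auto)
  then have "D (t + j) (u (t + j) a)" for j using not_approaching by blast
  then show False using not_right_forever[of t a] by (metis le_add_diff_inverse)
qed

theorem ordered:
  assumes "a \<triangleleft> b" shows "u t a < u t b"
proof (rule ccontr)
  assume "\<not> ?thesis"
  have "\<not> u (t + j) a < u (t + j) b" for j
  proof
    assume "u (t + j) a < u (t + j) b"
    \<comment> \<open>The extra \<open>j * period - j\<close> steps complete \<open>j\<close> to a
      multiple of the period.\<close>
    then have "u (t + j + (j * period - j)) a < u (t + j + (j * period - j)) b"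
      using assms ordered_later by blast
    moreover have "t + j + (j * period - j) = t + j * period" using period_pos by simp
    ultimately show False using \<open>\<not> u t a < u t b\<close> periodic_mult by simp
  qed
  moreover have "u t' a \<noteq> u t' b" for t'
    using bij_u[of t'] assms prec_irrefl by (metis bij_def injD)
  ultimately have "inverted (t + j) a b" for j
    using assms unfolding inverted_def by (meson linorder_neqE)
  then have "\<not> D (t + j) (u (t + j) b)" for j using inverted_left by blast
  then show False using not_left_forever[of t b] by (metis le_add_diff_inverse)
qed

end

section \<open>Words, labels and the bilinear form of a Coxeter system\<close>

context coxeter_system begin

lemma word_prod_Nil [simp]: "word_prod [] = \<one>"
  by (simp add: word_prod_def)

lemma word_prod_Cons [simp]: "word_prod (i # us) = s i \<otimes> word_prod us"
  by (simp add: word_prod_def)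

lemma word_prod_closed [simp]: "word_prod us \<in> carrier W"
  by (induction us) (auto simp: s_closed)

lemma word_prod_append: "word_prod (us @ vs) = word_prod us \<otimes> word_prod vs"
  by (induction us) (auto simp: s_closed m_assoc)

lemma s_s [simp]: "s i \<otimes> s i = \<one>"
proof -
  have "s i [^] (2::nat) = \<one>" using pow_ord_eq_1[OF s_closed] ord_s by metis
  then show ?thesis using s_closed by (simp add: numeral_2_eq_2)
qed

lemma inv_s [simp]: "inv (s i) = s i"
  using inv_equality s_closed s_s by blast

lemma ex_word: assumes "w \<in> carrier W" obtains us where "word_prod us = w"
proof -
  have "w \<in> generate W (range s)" using assms generate_s by simp
  then have "\<exists>us. word_prod us = w"
  proof induction
    case one then show ?case by (metis word_prod_Nil)
  next
    case (incl h)
    then obtain i where "h = s i" by blast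
    then have "word_prod [i] = h" using s_closed by simp
    then show ?case by blast
  next
    case (inv h)
    then obtain i where "h = s i" by blast
    then have "word_prod [i] = inv h" using s_closed by simp
    then show ?case by blast
  next
    case (eng h1 h2)
    then show ?case by (metis word_prod_append)
  qed
  then show thesis using that by blast
qed

lemma m_self: "m i i = 1"
proof -
  have "ord (s i \<otimes> s i) = 1" using ord_eq_1[OF one_closed] by simp
  then show ?thesis by (simp add: m_def one_enat_def)
qed

lemma m_eq_1_iff: "m i j = 1 \<longleftrightarrow> i = j"
proof
  assume "m i j = 1"
  then have "ord (s i \<otimes> s j) = 1" by (auto simp: m_def one_enat_def split: if_splits)
  then have "s i \<otimes> s j = \<one>" using ord_eq_1 s_closed by simp
  then have "s i = inv (s j)" using inv_equality s_closed by (metis inv_inv)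
  then show "i = j" using inj_s by (simp add: inj_eq)
qed (simp add: m_self)

lemma m_nonzero: "m i j \<noteq> 0"
  by (auto simp: m_def zero_enat_def)

lemma m_sym: "m i j = m j i"
proof -
  have "s j \<otimes> s i = inv (s i \<otimes> s j)" using s_closed inv_mult_group by simp
  then have "ord (s j \<otimes> s i) = ord (s i \<otimes> s j)" using ord_inv s_closed by simp
  then show ?thesis by (simp add: m_def)
qed

lemma B_simple_self [simp]: "B_simple i i = 1"
  by (simp add: B_simple_def m_self one_enat_def)

lemma B_simple_sym: "B_simple i j = B_simple j i"
  by (simp add: B_simple_def m_sym)

lemma B_simple_root: "B x (simple_root i) = (\<Sum>j\<in>UNIV. x $ j * B_simple j i)"
proof -
  have "(\<Sum>k\<in>UNIV. x $ j * axis i 1 $ k * B_simple j k) = x $ j * B_simple j i" for j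
    by (simp add: axis_def if_distrib[of "\<lambda>y. _ * y"] if_distrib[of "\<lambda>y. y * _"] cong: if_cong)
  then show ?thesis by (simp add: B_def simple_root_def)
qed

lemma B_add_left: "B (x + y) z = B x z + B y z"
  by (simp add: B_def algebra_simps sum.distrib)

lemma B_scale_left: "B (a *\<^sub>R x) z = a * B x z"
  by (simp add: B_def algebra_simps sum_distrib_left)

lemma B_diff_left: "B (x - y) z = B x z - B y z"
  by (simp add: B_def algebra_simps sum_subtractf)

lemma B_simple_root_simple_root: "B (simple_root i) (simple_root j) = B_simple i j"
proof -
  have "(\<Sum>k\<in>UNIV. axis i 1 $ k * B_simple k j) = B_simple i j"
    by (simp add: axis_def if_distrib[of "\<lambda>y. y * _"] cong: if_cong)
  then show ?thesis unfolding B_simple_root by (simp add: simple_root_def)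
qed

lemma simple_root_nth: "simple_root i $ k = (if k = i then 1 else 0)"
  by (simp add: simple_root_def axis_def)

lemma linear_simple_reflection: "linear (simple_reflection i)"
  by (rule linearI)
     (simp_all add: simple_reflection_def B_add_left B_scale_left algebra_simps)

lemma simple_reflection_nth:
  "simple_reflection i x $ k = x $ k - (if k = i then 2 * B x (simple_root i) else 0)"
  by (simp add: simple_reflection_def simple_root_nth)

lemma simple_reflection_invol [simp]: "simple_reflection i (simple_reflection i x) = x"
  by (simp add: simple_reflection_def B_diff_left B_scale_left B_simple_root_simple_root)

end

section \<open>The action on the root space and the orbits of toggles\<close>

locale crystallographic_coxeter_system = coxeter_system W s for W (structure) and s :: "'i::finite \<Rightarrow> 'a" +
  assumes m_crystallographic: "m i j \<in> {1, 2, 3, 4, 6, \<infinity>}"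
begin

text \<open>Both reflections move \<open>x\<close> only within the span of two simple roots, so it
  suffices to iterate the map \<open>F\<close> on the two coefficients. The few finite labels are
  then checked by computation; for 4 and 6, half the power has linear part -1 and is thus an
  involution.\<close>

lemma dihedral_relation:
  assumes "m i j = enat k"
  shows "((\<lambda>x. simple_reflection i (simple_reflection j x)) ^^ k) x = x"
proof (cases "i = j")
  case True
  then have "k = 1" using assms m_self by (simp add: one_enat_def)
  then show ?thesis using True by simp
next
  case False
  define b p q where "b = B_simple i j" and "p = B x (simple_root i)" and "q = B x (simple_root j)"
  define T where "T = (\<lambda>x. simple_reflection i (simple_reflection j x))"
  define F :: "real \<Rightarrow> real \<Rightarrow> real \<times> real" where
    "F y z = (- y - 2 * p - 2 * b * (- z - 2 * q - 2 * y * b), - z - 2 * q - 2 * y * b)" for y z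
  define X where "X = (\<lambda>(y, z). x + y *\<^sub>R simple_root i + z *\<^sub>R simple_root j)"
  have X: "T (X (y, z)) = X (F y z)" for y z
  proof -
    note X_simps = X_def vec_eq_iff simple_reflection_nth B_add_left B_scale_left
      B_simple_root_simple_root B_simple_sym[of j i] simple_root_nth
    have 1: "simple_reflection j (X (y, z)) = X (y, - z - 2 * q - 2 * y * b)"
      by (simp add: X_simps b_def p_def q_def)
    have 2: "simple_reflection i (X (y, z)) = X (- y - 2 * p - 2 * b * z, z)" for z
      by (simp add: X_simps b_def p_def q_def)
    show ?thesis by (simp add: T_def 1 2 F_def)
  qed
  have pow: "(T ^^ l) (X v) = X (((\<lambda>(y, z). F y z) ^^ l) v)" for l v
    by (induction l) (auto simp: X split: prod.splits)
  have "k \<in> {2, 3, 4, 6}" using m_crystallographic[of i j] m_eq_1_iff[of i j] False assms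
    by (auto simp: one_enat_def numeral_eq_enat)
  then have "((\<lambda>(y, z). F y z) ^^ k) (0, 0) = (0, 0)"
  proof (elim insertE emptyE)
    assume k: "k = 2"
    have "b = 0" using assms k by (simp add: b_def B_simple_def)
    then show ?thesis using k by (simp add: F_def numeral_2_eq_2)
  next
    assume k: "k = 3"
    have "b = - 1 / 2" using assms k by (simp add: b_def B_simple_def cos_60)
    then show ?thesis using k by (simp add: F_def numeral_3_eq_3)
  next
    assume k: "k = 4"
    have "b * b = 1 / 2" using assms k by (simp add: b_def B_simple_def cos_45)
    then have b: "b * b = 1 / 2" "b * (b * x) = 1 / 2 * x" for x
      by (auto simp flip: mult.assoc)
    have 2: "(\<lambda>(y, z). F y z) (F y z) = (4 * b * q - 4 * p - y, 4 * b * p - 4 * q - z)" for y z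
      by (simp add: F_def algebra_simps b)
    have "(f ^^ 4) v = f (f (f (f v)))" for f :: "real \<times> real \<Rightarrow> real \<times> real" and v
      by (simp add: numeral_eq_Suc)
    then show ?thesis using k 2 by simp
  next
    assume k: "k = 6"
    have "b * b = 3 / 4" using assms k by (simp add: b_def B_simple_def cos_30)
    then have b: "b * b = 3 / 4" "b * (b * x) = 3 / 4 * x" for x
      by (auto simp flip: mult.assoc)
    have 3: "(\<lambda>(y, z). F y z) ((\<lambda>(y, z). F y z) (F y z)) =
        (8 * b * q - 8 * p - y, 8 * b * p - 8 * q - z)" for y z
      by (simp add: F_def algebra_simps b)
    have "(f ^^ 6) v = f (f (f (f (f (f v)))))" for f :: "real \<times> real \<Rightarrow> real \<times> real" and v
      by (simp add: numeral_eq_Suc)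
    then show ?thesis using k 3 by simp
  qed
  then have "(T ^^ k) (X (0, 0)) = X (0, 0)" using pow by simp
  then show ?thesis by (simp add: X_def T_def)
qed

lemma foldr_replicate_pair:
  "foldr simple_reflection (concat (replicate k [i, j])) x =
    ((\<lambda>x. simple_reflection i (simple_reflection j x)) ^^ k) x"
  by (induction k) auto

lemma foldr_coxeter_equiv:
  assumes "coxeter_equiv us vs"
  shows "foldr simple_reflection us x = foldr simple_reflection vs x"
  using assms
proof (induction)
  case (relation i j k us vs)
  then show ?case by (simp add: foldr_replicate_pair dihedral_relation)
qed auto

text \<open>Uniqueness in the definite description comes from the presentation: words for the same
  element are \<open>coxeter_equiv\<close>, and the reflections satisfy the generating
  relations.\<close>

lemma act_word_prod: "act (word_prod us) x = foldr simple_reflection us x"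
  unfolding act_def
proof (rule the_equality)
  fix y assume "\<exists>vs. word_prod vs = word_prod us \<and> y = foldr simple_reflection vs x"
  then obtain vs where vs: "word_prod vs = word_prod us" "y = foldr simple_reflection vs x" by blast
  then have "coxeter_equiv vs us" using presentation by blast
  then show "y = foldr simple_reflection us x" using vs foldr_coxeter_equiv by simp
qed blast

lemma act_one [simp]: "act \<one> x = x"
  using act_word_prod[of "[]"] by simp

lemma act_s_mult: "w \<in> carrier W \<Longrightarrow> act (s i \<otimes> w) x = simple_reflection i (act w x)"
proof -
  assume "w \<in> carrier W"
  then obtain us where us: "w = word_prod us" using ex_word by metis
  show ?thesis unfolding us word_prod_Cons[symmetric] act_word_prod by simp
qed

lemma act_mult:
  assumes "v \<in> carrier W" "w \<in> carrier W"
  shows "act (v \<otimes> w) x = act v (act w x)"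
proof -
  obtain us vs where "word_prod us = v" "word_prod vs = w" using ex_word assms by metis
  then have "v = word_prod us" "w = word_prod vs" by auto
  then have "v \<otimes> w = word_prod (us @ vs)" by (simp add: word_prod_append)
  then show ?thesis using \<open>v = _\<close> \<open>w = _\<close> by (simp only: act_word_prod foldr_append o_apply)
qed

lemma act_inv [simp]:
  assumes "w \<in> carrier W"
  shows "act (inv w) (act w x) = x" "act w (act (inv w) x) = x"
proof -
  have "act (inv w) (act w x) = act (inv w \<otimes> w) x" "act w (act (inv w) x) = act (w \<otimes> inv w) x"
    using assms by (simp_all only: act_mult inv_closed)
  then show "act (inv w) (act w x) = x" "act w (act (inv w) x) = x" using assms by simp_all
qed

lemma linear_act: assumes "w \<in> carrier W" shows "linear (act w)"
proof -
  obtain us where us: "word_prod us = w" using ex_word assms by blast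
  have "linear (foldr simple_reflection us)"
  proof (induction us)
    case (Cons i us)
    then show ?case using linear_compose[OF Cons linear_simple_reflection[of i]] by (simp add: o_def)
  qed (simp add: linear_ident id_def)
  moreover have "act w = foldr simple_reflection us" using us act_word_prod by blast
  ultimately show ?thesis by simp
qed

lemma simple_root_in_roots [simp]: "simple_root i \<in> roots"
proof -
  have "simple_root i = act \<one> (simple_root i)" by simp
  then show ?thesis unfolding roots_def by blast
qed

lemma act_roots: "\<lbrakk>w \<in> carrier W; x \<in> roots\<rbrakk> \<Longrightarrow> act w x \<in> roots"
proof -
  assume "w \<in> carrier W" "x \<in> roots"
  then obtain v i where v: "v \<in> carrier W" "x = act v (simple_root i)" unfolding roots_def by blast
  then have "act w x = act (w \<otimes> v) (simple_root i)" using \<open>w \<in> carrier W\<close> by (simp add: act_mult)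
  then show ?thesis using v \<open>w \<in> carrier W\<close> unfolding roots_def by blast
qed

lemma positive_roots_act:
  "\<lbrakk>w \<in> carrier W; x \<in> roots\<rbrakk> \<Longrightarrow> act w x \<in> positive_roots \<longleftrightarrow> (\<forall>i. act w x $ i \<ge> 0)"
  by (simp add: positive_roots_def act_roots)

lemma roots_induct [consumes 1, case_names simple reflection]:
  assumes "x \<in> roots" "\<And>i. P (simple_root i)"
    "\<And>i y. y \<in> roots \<Longrightarrow> P y \<Longrightarrow> P (simple_reflection i y)"
  shows "P x"
proof -
  obtain w j where w: "w \<in> carrier W" "x = act w (simple_root j)"
    using assms(1) unfolding roots_def by blast
  obtain us where us: "word_prod us = w" using ex_word w(1) by blast
  have "P (act (word_prod us) (simple_root j))"
  proof (induction us)
    case (Cons i us)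
    then show ?case by (simp add: act_s_mult assms(3) act_roots)
  qed (use assms(2) in simp)
  then show ?thesis using w us by simp
qed

lemma R_iff:
  assumes "L \<subseteq> carrier W"
  shows "x \<in> R L \<longleftrightarrow> x \<in> roots \<and> (\<forall>w\<in>L. \<forall>i. act w x $ i \<ge> 0)"
  using assms unfolding R_def half_space_def
  by (auto simp: subset_iff positive_roots_act)

lemma toggle_closed [simp]: "w \<in> carrier W \<Longrightarrow> toggle L i w \<in> carrier W"
  by (simp add: toggle_def s_closed)

text \<open>Splits the powers of \<open>promotion\<close> into single toggles, because the arguments
  depend on the states inside a round.\<close>

primrec orbit :: "'a set \<Rightarrow> 'i list \<Rightarrow> 'a \<Rightarrow> nat \<Rightarrow> 'a" where
  "orbit L us w 0 = w"
| "orbit L us w (Suc t) = toggle L (us ! (t mod length us)) (orbit L us w t)"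

lemma orbit_closed [simp]: "w \<in> carrier W \<Longrightarrow> orbit L us w t \<in> carrier W"
  by (induction t) auto

lemma orbit_le_length: "t \<le> length us \<Longrightarrow> orbit L us w t = fold (toggle L) (take t us) w"
proof (induction t)
  case (Suc t)
  then show ?case by (simp add: take_Suc_conv_app_nth)
qed simp

lemma orbit_add:
  assumes "length us dvd t" shows "orbit L us w (t + j) = orbit L us (orbit L us w t) j"
proof -
  have "(t + i) mod length us = i mod length us" for i
    using assms by (auto elim!: dvdE)
  then show ?thesis by (induction j) auto
qed

lemma orbit_mult_length: "orbit L us w (K * length us) = (promotion L us ^^ K) w"
proof (induction K)
  case (Suc K)
  have "orbit L us w (K * length us + length us) = promotion L us (orbit L us w (K * length us))"
    by (subst orbit_add) (auto simp: orbit_le_length promotion_def)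
  then show ?case using Suc by (simp add: add.commute)
qed simp

text \<open>Heaviness only has to be tested one separating root at a time.\<close>

lemma heavyI:
  assumes L: "convex_subset L"
    and "\<And>is u K x. \<lbrakk>distinct is; set is = UNIV; u \<in> carrier W; K > 0;
      \<And>t. orbit L is u (t + K * length is) = orbit L is u t; x \<in> R L\<rbrakk>
      \<Longrightarrow> act u x \<in> positive_roots"
  shows "heavy L c"
  unfolding heavy_def
proof (intro allI impI ballI)
  fix "is" u assume "is": "ordering_for c is" and u: "u \<in> carrier W"
    and "\<exists>K\<ge>1. (promotion L is ^^ K) u = u"
  then obtain K where K: "K \<ge> 1" "(promotion L is ^^ K) u = u" by blast
  have per: "orbit L is u (t + K * length is) = orbit L is u t" for t
    using orbit_add[of "is" "K * length is" L u t] K(2) orbit_mult_length[of L "is" u K]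
    by (simp add: add.commute)
  obtain A where A: "A \<subseteq> roots" "L = carrier W \<inter> (\<Inter>x\<in>A. half_space x)"
    using L unfolding convex_subset_def by blast
  have "u \<in> half_space x" if "x \<in> A" for x
  proof -
    have "x \<in> R L" using A that unfolding R_def by auto
    then have "act u x \<in> positive_roots"
      using assms(2)[of "is" u K x] "is" u per K(1) unfolding ordering_for_def by auto
    then show ?thesis using u unfolding half_space_def by simp
  qed
  then show "u \<in> L" using A u by auto
qed

end

section \<open>Groups acting by permutations of the integers\<close>

lemma int_shift_invariant:
  fixes f :: "int \<Rightarrow> 'b"
  assumes "\<And>k. f (k + 1) = f k" shows "f a = f b"
proof -
  have "f k = f 0" for k
  proof (induction k rule: int_induct[of _ 0])
    case (step2 i)
    then show ?case using assms[of "i - 1"] by simp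
  qed (use assms in auto)
  then show ?thesis by metis
qed

lemma mod_pred:
  "0 < n \<Longrightarrow> (a - 1) mod n = (if a mod n = 0 then n - 1 else a mod n - 1)" for a n :: int
proof -
  assume n: "0 < n"
  have "(a - 1) mod n = (a mod n - 1) mod n" by (simp add: mod_diff_left_eq)
  also have "\<dots> = (if a mod n = 0 then n - 1 else a mod n - 1)"
    using n pos_mod_bound[OF n, of a] pos_mod_sign[OF n, of a]
    by (auto simp: zmod_minus1 intro!: mod_pos_pos_trivial)
  finally show ?thesis .
qed

text \<open>\<open>node\<close> is a walk in the Coxeter graph, around the cycle in type A and back
  and forth along the path in type C. The weights \<open>c\<close> undo the normalization of simple
  roots to unit norm. \<open>node_adjacent\<close> says that reflecting a step in another node adds
  those of its two neighbouring steps that lie over that node.\<close>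

locale cyclic_cover = crystallographic_coxeter_system W s
  for W (structure) and s :: "'i::finite \<Rightarrow> 'a" +
  fixes node :: "int \<Rightarrow> 'i" and c :: "'i \<Rightarrow> real"
  assumes node_surj: "\<exists>k. node k = i"
    and c_pos: "c i > 0"
    and node_Suc: "node (k + 1) \<noteq> node k"
    and node_adjacent: "node k \<noteq> i \<Longrightarrow> - 2 * c (node k) * B_simple (node k) i =
      c i * (of_bool (node (k + 1) = i) + of_bool (node (k - 1) = i))"
    and node_miss: "m i j \<noteq> \<infinity> \<Longrightarrow> \<exists>p. node p \<notin> {i, j}"
begin

lemma node_pred: "node (k - 1) \<noteq> node k"
  using node_Suc[of "k - 1"] by simp

definition step :: "int \<Rightarrow> real ^ 'i" where
  "step k = c (node k) *\<^sub>R simple_root (node k)"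

definition P :: "int \<Rightarrow> real ^ 'i" where
  "P k = (\<Sum>j\<in>{0..<k}. step j) - (\<Sum>j\<in>{k..<0}. step j)"

lemma P_Suc: "P (k + 1) = P k + step k"
proof (cases "k \<ge> 0")
  case True
  then have "{0..<k + 1} = insert k {0..<k}" by auto
  then show ?thesis using True by (simp add: P_def)
next
  case False
  then have "{k..<0} = insert k {k + 1..<0}" by auto
  then show ?thesis using False by (simp add: P_def)
qed

text \<open>The linear form with value 1 on every \<open>step\<close>; it recovers
  \<open>b - a\<close> from \<open>P b - P a\<close>.\<close>

definition label_diff :: "real ^ 'i \<Rightarrow> real" where
  "label_diff x = (\<Sum>i\<in>UNIV. x $ i / c i)"

lemma label_diff_step [simp]: "label_diff (step k) = 1"
proof -
  have "label_diff (step k) = (\<Sum>i\<in>UNIV. if i = node k then 1 else 0)"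
    unfolding label_diff_def step_def
    by (rule sum.cong) (use c_pos[of "node k"] in \<open>auto simp: simple_root_nth\<close>)
  then show ?thesis by simp
qed

lemma label_diff_add: "label_diff (x + y) = label_diff x + label_diff y"
  by (simp add: label_diff_def add_divide_distrib sum.distrib)

lemma label_diff_P: "label_diff (P b - P a) = b - a"
proof -
  have "label_diff (P (k + 1) - P a) - real_of_int (k + 1) = label_diff (P k - P a) - real_of_int k" for k
    using label_diff_add[of "P k - P a" "step k"] by (simp add: P_Suc add_diff_eq[symmetric] diff_add_eq)
  from int_shift_invariant[of "\<lambda>k. label_diff (P k - P a) - real_of_int k", OF this, of b a]
  show ?thesis by (simp add: label_diff_def)
qed

lemma P_diff_nonneg: "(\<forall>i. (P b - P a) $ i \<ge> 0) \<longleftrightarrow> a \<le> b"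
proof
  assume "\<forall>i. (P b - P a) $ i \<ge> 0"
  then have "label_diff (P b - P a) \<ge> 0"
    unfolding label_diff_def using c_pos by (intro sum_nonneg divide_nonneg_nonneg) (auto intro: less_imp_le)
  then show "a \<le> b" by (simp add: label_diff_P)
next
  assume "a \<le> b"
  then show "\<forall>i. (P b - P a) $ i \<ge> 0"
  proof (induction b rule: int_ge_induct)
    case (step b)
    have "step b $ i \<ge> 0" for i
      using c_pos[of "node b"] by (simp add: step_def simple_root_nth)
    then show ?case using step by (simp add: P_Suc) (metis add_increasing2 diff_ge_0_iff_ge le_add_diff_inverse2)
  qed simp
qed

definition swap :: "'i \<Rightarrow> int \<Rightarrow> int" where
  "swap i k = (if node k = i then k + 1 else if node (k - 1) = i then k - 1 else k)"

lemma swap_swap [simp]: "swap i (swap i k) = k"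
  using node_Suc[of k] node_pred[of k] by (auto simp: swap_def)

lemma simple_reflection_step:
  "simple_reflection i (step k) = P (swap i (k + 1)) - P (swap i k)"
proof (cases "node k = i")
  case True
  have "simple_reflection i (step k) = - step k"
    using True by (simp add: vec_eq_iff simple_reflection_nth step_def B_scale_left
        B_simple_root_simple_root simple_root_nth)
  then show ?thesis using True node_Suc[of k] by (simp add: swap_def P_Suc)
next
  case False
  have "simple_reflection i (step k) = step k +
      (of_bool (node (k + 1) = i) + of_bool (node (k - 1) = i)) *\<^sub>R (c i *\<^sub>R simple_root i)"
    using node_adjacent[OF False]
    by (simp add: vec_eq_iff simple_reflection_nth step_def B_scale_left
        B_simple_root_simple_root simple_root_nth algebra_simps)
  moreover have "P (k + 1 + 1) = P k + step k + step (k + 1)" by (simp only: P_Suc)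
  moreover have "P k = P (k - 1) + step (k - 1)" using P_Suc[of "k - 1"] by simp
  ultimately show ?thesis using False P_Suc[of k]
    by (auto simp: swap_def step_def algebra_simps)
qed

lemma simple_reflection_P:
  "simple_reflection i (P b - P a) = P (swap i b) - P (swap i a)"
proof -
  have "simple_reflection i (P (k + 1)) - P (swap i (k + 1)) = simple_reflection i (P k) - P (swap i k)" for k
  proof -
    have "simple_reflection i (P (k + 1)) = simple_reflection i (P k) + simple_reflection i (step k)"
      by (simp add: P_Suc linear_add[OF linear_simple_reflection])
    then show ?thesis using simple_reflection_step[of i k] by (simp add: algebra_simps)
  qed
  from int_shift_invariant[of "\<lambda>k. simple_reflection i (P k) - P (swap i k)", OF this, of b a]
  have "simple_reflection i (P b) - P (swap i b) = simple_reflection i (P a) - P (swap i a)" .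
  then show ?thesis by (simp add: linear_diff[OF linear_simple_reflection] algebra_simps)
qed

abbreviation perm :: "'i list \<Rightarrow> int \<Rightarrow> int" where
  "perm us \<equiv> foldr swap us"

lemma foldr_simple_reflection_P:
  "foldr simple_reflection us (P b - P a) = P (perm us b) - P (perm us a)"
  by (induction us) (auto simp: simple_reflection_P)

text \<open>The action on the root space determines the permutation up to a shift, and the shift is
  excluded by the initial segment of \<open>\<int>\<close> ending at a node \<open>p\<close> that the word avoids.\<close>

lemma perm_avoid:
  assumes "node p \<notin> set us" shows "perm us k \<le> p \<longleftrightarrow> k \<le> p"
  using assms
proof (induction us)
  case (Cons i us)
  have "swap i k \<le> p \<longleftrightarrow> k \<le> p" for k
  proof -
    have "k \<noteq> p" if "node k = i" using Cons.prems that by auto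
    moreover have "k \<noteq> p + 1" if "node (k - 1) = i" using Cons.prems that by auto
    ultimately show ?thesis by (auto simp: swap_def)
  qed
  then show ?case using Cons by simp
qed simp

lemma perm_relation:
  assumes "m i j = enat k" shows "perm (concat (replicate k [i, j])) a = a"
proof -
  define us where "us = concat (replicate k [i, j])"
  obtain p where "node p \<notin> {i, j}" using node_miss assms by fastforce
  moreover have "set us \<subseteq> {i, j}" by (auto simp: us_def)
  ultimately have p: "perm us l \<le> p \<longleftrightarrow> l \<le> p" for l by (intro perm_avoid) auto
  have eq: "perm us b - perm us d = b - d" for b d
  proof -
    have "P (perm us b) - P (perm us d) = P b - P d"
      unfolding us_def foldr_simple_reflection_P[symmetric] foldr_replicate_pair
      by (rule dihedral_relation[OF assms])
    then have "label_diff (P (perm us b) - P (perm us d)) = label_diff (P b - P d)" by simp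
    then show ?thesis unfolding label_diff_P by linarith
  qed
  \<comment> \<open>By \<open>eq\<close> the permutation is a translation; preserving the initial
    segment up to \<open>p\<close> leaves only the translation by 0.\<close>
  have "perm us a = a"
    using p[of p] p[of "p + 1"] eq[of "p + 1" p] eq[of a p] by auto
  then show ?thesis by (simp add: us_def)
qed

lemma perm_coxeter_equiv: "coxeter_equiv us vs \<Longrightarrow> perm us a = perm vs a"
  by (induction rule: coxeter_equiv.induct) (auto simp: perm_relation)

definition pos :: "'a \<Rightarrow> int \<Rightarrow> int" where
  "pos w = perm (SOME us. word_prod us = w)"

lemma pos_word_prod: "pos (word_prod us) = perm us"
proof -
  have "word_prod (SOME vs. word_prod vs = word_prod us) = word_prod us" by (rule someI) simp
  then show ?thesis unfolding pos_def using presentation perm_coxeter_equiv by blast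
qed

lemma pos_s_mult: "w \<in> carrier W \<Longrightarrow> pos (s i \<otimes> w) a = swap i (pos w a)"
proof -
  assume "w \<in> carrier W"
  then obtain us where us: "w = word_prod us" using ex_word by metis
  show ?thesis unfolding us word_prod_Cons[symmetric] pos_word_prod by simp
qed

lemma bij_pos: assumes "w \<in> carrier W" shows "bij (pos w)"
proof -
  obtain us where us: "w = word_prod us" using ex_word assms by metis
  have "bij (swap i)" for i by (rule o_bij[of "swap i"]) auto
  then have "bij (perm us)" by (induction us) (auto intro: bij_comp)
  then show ?thesis by (simp add: us pos_word_prod)
qed

lemma act_P:
  assumes "w \<in> carrier W" shows "act w (P b - P a) = P (pos w b) - P (pos w a)"
proof -
  obtain us where us: "w = word_prod us" using ex_word assms by metis
  show ?thesis unfolding us act_word_prod pos_word_prod by (rule foldr_simple_reflection_P)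
qed

lemma act_inv_simple_root:
  assumes u: "u \<in> carrier W" and ab: "pos u a = k" "pos u b = k + 1"
  shows "act (inv u) (simple_root (node k)) = (1 / c (node k)) *\<^sub>R (P b - P a)"
proof -
  have "act u (P b - P a) = c (node k) *\<^sub>R simple_root (node k)"
    using act_P[OF u] ab by (simp add: P_Suc step_def)
  then have "P b - P a = c (node k) *\<^sub>R act (inv u) (simple_root (node k))"
    using act_inv(1)[OF u, of "P b - P a"] linear_scale[OF linear_act[of "inv u"]] u by simp
  then show ?thesis using c_pos[of "node k"] by simp
qed

lemma root_eq_P:
  assumes "x \<in> roots"
  obtains a b d where "x = d *\<^sub>R (P b - P a)" "d > 0" "a \<noteq> b"
proof -
  obtain w i where w: "w \<in> carrier W" "x = act w (simple_root i)"
    using assms unfolding roots_def by blast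
  obtain k where k: "node k = i" using node_surj by blast
  obtain a b where ab: "pos (inv w) a = k" "pos (inv w) b = k + 1"
  proof -
    have "surj (pos (inv w))" using bij_is_surj bij_pos w(1) by blast
    then show thesis using that surjD[of "pos (inv w)" k] surjD[of "pos (inv w)" "k + 1"] by auto
  qed
  have "x = (1 / c i) *\<^sub>R (P b - P a)"
    using act_inv_simple_root[of "inv w" a k b] ab w k by simp
  moreover have "a \<noteq> b" using ab by auto
  ultimately show thesis using that[of "1 / c i" b a] c_pos[of i] by auto
qed

definition before :: "'a set \<Rightarrow> int \<Rightarrow> int \<Rightarrow> bool" where
  "before L a b \<longleftrightarrow> (\<forall>w\<in>L. pos w a < pos w b)"

lemma act_scale_P_nonneg:
  assumes "w \<in> carrier W" "d > 0" "a \<noteq> b"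
  shows "(\<forall>i. act w (d *\<^sub>R (P b - P a)) $ i \<ge> 0) \<longleftrightarrow> pos w a < pos w b"
proof -
  have "act w (d *\<^sub>R (P b - P a)) = d *\<^sub>R (P (pos w b) - P (pos w a))"
    using linear_scale[OF linear_act[OF assms(1)]] act_P[OF assms(1)] by simp
  moreover have "pos w a \<noteq> pos w b" using bij_pos[OF assms(1)] assms(3) by (metis bij_def injD)
  ultimately show ?thesis using P_diff_nonneg[of "pos w b" "pos w a"] assms(2)
    by (auto simp: zero_le_mult_iff)
qed

lemma R_iff_before:
  assumes "L \<subseteq> carrier W" "d *\<^sub>R (P b - P a) \<in> roots" "d > 0" "a \<noteq> b"
  shows "d *\<^sub>R (P b - P a) \<in> R L \<longleftrightarrow> before L a b"
  using assms act_scale_P_nonneg unfolding R_iff[OF assms(1)] before_def by blast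

text \<open>By \<open>act_inv_simple_root\<close> the root tested by the toggle compares the labels
  at \<open>k\<close> and \<open>k + 1\<close>. All \<open>k\<close> over one node yield the same
  root, hence the same verdict.\<close>

lemma toggle_node:
  assumes L: "L \<subseteq> carrier W" and u: "u \<in> carrier W" and ab: "pos u a = k" "pos u b = k + 1"
  shows "toggle L (node k) u = (if before L a b then u else s (node k) \<otimes> u)"
proof -
  have "act (inv u) (simple_root (node k)) \<in> roots" using u by (simp add: act_roots)
  moreover have "a \<noteq> b" using ab by auto
  ultimately show ?thesis
    unfolding toggle_def act_inv_simple_root[OF u ab]
    using R_iff_before[OF L, of "1 / c (node k)" b a] c_pos[of "node k"] by simp
qed

lemma toggle_idle:
  assumes "u \<in> carrier W" "node (pos u a) \<noteq> i" "node (pos u a - 1) \<noteq> i"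
  shows "pos (toggle L i u) a = pos u a"
  using assms by (simp add: toggle_def pos_s_mult swap_def)

theorem futuristic: futuristic
  unfolding futuristic_def
proof (intro allI impI)
  fix L g assume asm: "convex_subset L \<and> L \<noteq> {} \<and> coxeter_element g"
  then have LW: "L \<subseteq> carrier W" unfolding convex_subset_def by auto
  show "heavy L g"
  proof (rule heavyI)
    show "convex_subset L" using asm by blast
    fix "is" u K x
    assume "is": "distinct is" "set is = UNIV" and u: "u \<in> carrier W" and K: "K > 0"
      and per: "\<And>t. orbit L is u (t + K * length is) = orbit L is u t" and x: "x \<in> R L"
    define n where "n = int (length is)"
    have n: "n > 0" using "is" by (auto simp: n_def)
    have "\<forall>i. \<exists>j. j < length is \<and> is ! j = i" using "is"(2) by (metis UNIV_I in_set_conv_nth)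
    then obtain idx where idx: "\<And>i. idx i < length is" "\<And>i. is ! idx i = i" by metis
    have idx_nth: "idx (is ! j) = j" if "j < length is" for j
      using idx that "is"(1) nth_eq_iff_index_eq by metis
    \<comment> \<open>the number of steps until the next toggle at a given node\<close>
    define nx where "nx t i = (int (idx i) - int t) mod n" for t i
    have nx_range: "0 \<le> nx t i" "nx t i < n" for t i using n by (auto simp: nx_def)
    have nx_Suc: "nx (Suc t) i = (if nx t i = 0 then n - 1 else nx t i - 1)" for t i
      using mod_pred[OF n, of "int (idx i) - int t"] by (simp add: nx_def algebra_simps)
    have nx_inj: "i = j" if "nx t i = nx t j" for t i j
    proof -
      have "int (idx i) mod n = int (idx j) mod n"
        using that unfolding nx_def by (metis diff_add_cancel mod_add_left_eq)
      then have "idx i = idx j" using idx(1) by (simp add: n_def)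
      then show ?thesis using idx(2) by metis
    qed
    have nx_0: "nx t i = 0 \<longleftrightarrow> is ! (t mod length is) = i" for t i
    proof -
      have "nx t (is ! (t mod length is)) = 0"
        using idx_nth[of "t mod length is"] n
        by (simp add: nx_def n_def zmod_int mod_diff_left_eq)
      then show ?thesis using nx_inj by metis
    qed
    define T where "T t = {k. node k = is ! (t mod length is)}" for t
    \<comment> \<open>A stone heads for whichever of its two adjacent toggles comes sooner. A toggle
      resets its own waiting time to the maximum \<open>n - 1\<close>, so two stones that have just
      passed keep their directions.\<close>
    define D where "D t k \<longleftrightarrow> nx t (node k) < nx t (node (k - 1))" for t k
    have T_iff: "k \<in> T t \<longleftrightarrow> nx t (node k) = 0" for k t by (auto simp: T_def nx_0)
    interpret stones "\<lambda>t. pos (orbit L is u t)" T D "before L" "K * length is"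
    proof
      fix t a b d k
      show "bij (pos (orbit L is u t))" using u by (simp add: bij_pos)
      show "pos (orbit L is u (Suc t)) a = k \<and> pos (orbit L is u (Suc t)) b = k + 1"
        if "pos (orbit L is u t) a = k" "pos (orbit L is u t) b = k + 1" "k \<in> T t" "before L a b"
        using toggle_node[OF LW _ that(1,2)] u that by (simp add: T_def)
      show "pos (orbit L is u (Suc t)) a = k + 1 \<and> pos (orbit L is u (Suc t)) b = k"
        if "pos (orbit L is u t) a = k" "pos (orbit L is u t) b = k + 1" "k \<in> T t" "\<not> before L a b"
      proof -
        have "orbit L is u (Suc t) = s (node k) \<otimes> orbit L is u t"
          using toggle_node[OF LW _ that(1,2)] u that by (simp add: T_def)
        then show ?thesis using u that(1,2) node_Suc[of k] by (simp add: pos_s_mult swap_def)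
      qed
      show "pos (orbit L is u (Suc t)) a = pos (orbit L is u t) a"
        if "pos (orbit L is u t) a \<notin> T t" "pos (orbit L is u t) a - 1 \<notin> T t"
        using that u by (simp add: T_def toggle_idle)
      have ne: "nx t (node (k - 1)) \<noteq> nx t (node k)" "nx t (node (k + 1)) \<noteq> nx t (node k)" for k t
        using nx_inj node_pred node_Suc by metis+
      show "D t k \<and> \<not> D t (k + 1) \<and> \<not> D (Suc t) k \<and> D (Suc t) (k + 1)" if "k \<in> T t"
        using that ne[of t k] nx_range[of t "node (k - 1)"] nx_range[of t "node (k + 1)"]
        by (auto simp: T_iff D_def nx_Suc)
      show "D (Suc t) k = D t k" if "k \<notin> T t" "k - 1 \<notin> T t"
        using that by (auto simp: T_iff D_def nx_Suc)
      show "\<exists>t'\<ge>t. k \<in> T t'"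
      proof (intro exI conjI)
        \<comment> \<open>The node has its turn at offset \<open>idx (node k)\<close> of every
          round, and round \<open>t\<close> starts no earlier than time \<open>t\<close>.\<close>
        show "t \<le> idx (node k) + t * length is" using n by (cases "length is") (auto simp: n_def)
        show "k \<in> T (idx (node k) + t * length is)" using idx by (simp add: T_def)
      qed
      show "before L a d" if "before L a b" "before L b d"
        using that unfolding before_def by fastforce
      \<comment> \<open>Nonemptiness of \<open>L\<close> enters here.\<close>
      show "\<not> before L a a" using asm unfolding before_def by auto
      show "0 < K * length is" using K n by (simp add: n_def)
      show "pos (orbit L is u (t + K * length is)) = pos (orbit L is u t)" using per by simp
    qed
    have "x \<in> roots" using x unfolding R_def by blast
    then obtain a b d where abd: "x = d *\<^sub>R (P b - P a)" "d > 0" "a \<noteq> b" by (rule root_eq_P)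
    then have "before L a b" using R_iff_before[OF LW] x \<open>x \<in> roots\<close> by blast
    then have "pos u a < pos u b" using ordered[of a b 0] by simp
    then show "act u x \<in> positive_roots"
      using act_scale_P_nonneg[OF u abd(2,3)] abd(1) u \<open>x \<in> roots\<close> by (simp add: positive_roots_act)
  qed
qed

end

section \<open>The root system of affine type G2\<close>

lemma sqrt_3_mult: "sqrt 3 * (sqrt 3 * t) = 3 * t"
  by (simp flip: mult.assoc)

text \<open>Four times the equation \<open>B x x = 1\<close> after completing squares, in the
  integer coordinates of \<open>long_root\<close> and \<open>short_root\<close>.\<close>

definition norm4 :: "int \<Rightarrow> int \<Rightarrow> bool" where
  "norm4 y z \<longleftrightarrow> y\<^sup>2 + 3 * z\<^sup>2 = 4"

lemma norm4_cases:
  assumes "norm4 y z"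
  shows "(y = 2 \<or> y = - 2) \<and> z = 0 \<or> (y = 1 \<or> y = - 1) \<and> (z = 1 \<or> z = - 1)"
proof -
  have "3 * z\<^sup>2 \<le> 4" using assms zero_le_power2[of y] unfolding norm4_def by linarith
  then have z2: "z\<^sup>2 < 2\<^sup>2" by simp
  then have "\<bar>z\<bar> < 2" using power2_less_imp_less[of "\<bar>z\<bar>" 2] by simp
  then consider "z = 0" | "z = 1" | "z = - 1" by linarith
  then show ?thesis
  proof cases
    case 1
    then have "y\<^sup>2 = 2\<^sup>2" using assms by (simp add: norm4_def)
    then show ?thesis using 1 by (simp only: power2_eq_iff) simp
  qed (use assms in \<open>auto simp: norm4_def power2_eq_1_iff\<close>)
qed

locale g2_system = crystallographic_coxeter_system W s
  for W (structure) and s :: "'i::finite \<Rightarrow> 'a" +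
  fixes i0 i1 i2 :: 'i
  assumes UNIV_eq: "UNIV = {i0, i1, i2}"
    and distinct: "i0 \<noteq> i1" "i1 \<noteq> i2" "i0 \<noteq> i2"
    and B_simple_01: "B_simple i0 i1 = - 1 / 2"
    and B_simple_12: "B_simple i1 i2 = - sqrt 3 / 2"
    and B_simple_02: "B_simple i0 i2 = 0"
begin

lemma all_iff: "(\<forall>i. Q i) \<longleftrightarrow> Q i0 \<and> Q i1 \<and> Q i2"
  using UNIV_eq by (metis UNIV_I empty_iff insert_iff)

lemma vec_eq_iff3: "x = y \<longleftrightarrow> x $ i0 = y $ i0 \<and> x $ i1 = y $ i1 \<and> x $ i2 = y $ i2" for x y :: "real ^ 'i"
  unfolding vec_eq_iff by (rule all_iff)

lemma B_simple_root_coords: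
  "B x (simple_root i0) = x $ i0 - x $ i1 / 2"
  "B x (simple_root i1) = x $ i1 - (x $ i0 + sqrt 3 * x $ i2) / 2"
  "B x (simple_root i2) = x $ i2 - sqrt 3 * x $ i1 / 2"
  using distinct unfolding B_simple_root UNIV_eq
  by (simp_all add: B_simple_01 B_simple_12 B_simple_02 B_simple_sym[of i1 i0] B_simple_sym[of i2 i1]
      B_simple_sym[of i2 i0] field_simps)

lemma reflection_coords:
  "simple_reflection i0 x $ i0 = x $ i1 - x $ i0"
  "simple_reflection i0 x $ i1 = x $ i1"
  "simple_reflection i0 x $ i2 = x $ i2"
  "simple_reflection i1 x $ i0 = x $ i0"
  "simple_reflection i1 x $ i1 = x $ i0 + sqrt 3 * x $ i2 - x $ i1"
  "simple_reflection i1 x $ i2 = x $ i2"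
  "simple_reflection i2 x $ i0 = x $ i0"
  "simple_reflection i2 x $ i1 = x $ i1"
  "simple_reflection i2 x $ i2 = sqrt 3 * x $ i1 - x $ i2"
  using distinct by (simp_all add: simple_reflection_nth B_simple_root_coords field_simps)

lemma root_norm:
  assumes "x \<in> roots"
  shows "(x $ i0)\<^sup>2 + (x $ i1)\<^sup>2 + (x $ i2)\<^sup>2 - x $ i0 * x $ i1 - sqrt 3 * x $ i1 * x $ i2 = 1"
  using assms
proof (induction rule: roots_induct)
  case (simple i)
  have "\<forall>i. (simple_root i $ i0)\<^sup>2 + (simple_root i $ i1)\<^sup>2 + (simple_root i $ i2)\<^sup>2 -
      simple_root i $ i0 * simple_root i $ i1 - sqrt 3 * simple_root i $ i1 * simple_root i $ i2 = 1"
    unfolding all_iff using distinct by (simp add: simple_root_nth)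
  then show ?case by blast
next
  case (reflection i y)
  have "\<forall>i. (simple_reflection i y $ i0)\<^sup>2 + (simple_reflection i y $ i1)\<^sup>2 + (simple_reflection i y $ i2)\<^sup>2 -
      simple_reflection i y $ i0 * simple_reflection i y $ i1 -
      sqrt 3 * simple_reflection i y $ i1 * simple_reflection i y $ i2 = 1"
    unfolding all_iff reflection_coords using reflection(2)
    by (simp add: power2_eq_square algebra_simps)
  then show ?case by blast
qed

text \<open>Roots have unit norm here, whereas integral coordinates belong to lengths in ratio
  \<open>sqrt 3\<close>; this is the origin of the factors. The simple roots at \<open>i0\<close>
  and \<open>i1\<close> are long, the one at \<open>i2\<close> is short.\<close>

definition long_root :: "real ^ 'i \<Rightarrow> bool" where
  "long_root x \<longleftrightarrow> (\<exists>(a :: int) (b :: int) (c :: int). x $ i0 = a \<and> x $ i1 = b \<and> x $ i2 = sqrt 3 * c \<and>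
    norm4 (2 * a - b) (2 * c - b))"

definition short_root :: "real ^ 'i \<Rightarrow> bool" where
  "short_root x \<longleftrightarrow> (\<exists>(a :: int) (b :: int) (c :: int). x $ i0 = sqrt 3 * a \<and> x $ i1 = sqrt 3 * b \<and> x $ i2 = c \<and>
    norm4 (2 * c - 3 * b) (2 * a - b))"

lemma long_root_reflection: assumes "long_root x" shows "\<forall>i. long_root (simple_reflection i x)"
proof -
  obtain a b c :: int where x: "x $ i0 = a" "x $ i1 = b" "x $ i2 = sqrt 3 * c"
    and eq: "norm4 (2 * a - b) (2 * c - b)"
    using assms unfolding long_root_def by blast
  show ?thesis unfolding all_iff long_root_def reflection_coords x
  proof (intro conjI)
    show "\<exists>a' b' c'. real_of_int b - real_of_int a = real_of_int a' \<and> real_of_int b = real_of_int b' \<and>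
        sqrt 3 * real_of_int c = sqrt 3 * real_of_int c' \<and> norm4 (2 * a' - b') (2 * c' - b')"
      using eq by (intro exI[of _ "b - a"] exI[of _ b] exI[of _ c]) (simp add: norm4_def power2_eq_square algebra_simps)
    show "\<exists>a' b' c'. real_of_int a = real_of_int a' \<and>
        real_of_int a + sqrt 3 * (sqrt 3 * real_of_int c) - real_of_int b = real_of_int b' \<and>
        sqrt 3 * real_of_int c = sqrt 3 * real_of_int c' \<and> norm4 (2 * a' - b') (2 * c' - b')"
    proof (intro exI conjI)
      show "norm4 (2 * a - (a + 3 * c - b)) (2 * c - (a + 3 * c - b))"
        using eq by (simp add: norm4_def power2_eq_square algebra_simps)
    qed (simp_all add: sqrt_3_mult)
    show "\<exists>a' b' c'. real_of_int a = real_of_int a' \<and> real_of_int b = real_of_int b' \<and>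
        sqrt 3 * real_of_int b - sqrt 3 * real_of_int c = sqrt 3 * real_of_int c' \<and>
        norm4 (2 * a' - b') (2 * c' - b')"
      using eq by (intro exI[of _ a] exI[of _ b] exI[of _ "b - c"]) (simp add: norm4_def power2_eq_square algebra_simps)
  qed
qed

lemma short_root_reflection: assumes "short_root x" shows "\<forall>i. short_root (simple_reflection i x)"
proof -
  obtain a b c :: int where x: "x $ i0 = sqrt 3 * a" "x $ i1 = sqrt 3 * b" "x $ i2 = c"
    and eq: "norm4 (2 * c - 3 * b) (2 * a - b)"
    using assms unfolding short_root_def by blast
  show ?thesis unfolding all_iff short_root_def reflection_coords x
  proof (intro conjI)
    show "\<exists>a' b' c'. sqrt 3 * real_of_int b - sqrt 3 * real_of_int a = sqrt 3 * real_of_int a' \<and>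
        sqrt 3 * real_of_int b = sqrt 3 * real_of_int b' \<and>
        real_of_int c = real_of_int c' \<and> norm4 (2 * c' - 3 * b') (2 * a' - b')"
      using eq by (intro exI[of _ "b - a"] exI[of _ b] exI[of _ c]) (simp add: norm4_def power2_eq_square algebra_simps)
    show "\<exists>a' b' c'. sqrt 3 * real_of_int a = sqrt 3 * real_of_int a' \<and>
        sqrt 3 * real_of_int a + sqrt 3 * real_of_int c - sqrt 3 * real_of_int b = sqrt 3 * real_of_int b' \<and>
        real_of_int c = real_of_int c' \<and> norm4 (2 * c' - 3 * b') (2 * a' - b')"
      using eq by (intro exI[of _ a] exI[of _ "a + c - b"] exI[of _ c])
        (simp add: norm4_def power2_eq_square algebra_simps)
    show "\<exists>a' b' c'. sqrt 3 * real_of_int a = sqrt 3 * real_of_int a' \<and>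
        sqrt 3 * real_of_int b = sqrt 3 * real_of_int b' \<and>
        sqrt 3 * (sqrt 3 * real_of_int b) - real_of_int c = real_of_int c' \<and>
        norm4 (2 * c' - 3 * b') (2 * a' - b')"
    proof (intro exI conjI)
      show "norm4 (2 * (3 * b - c) - 3 * b) (2 * a - b)"
        using eq by (simp add: norm4_def power2_eq_square algebra_simps)
    qed (simp_all add: sqrt_3_mult)
  qed
qed

lemma long_or_short: assumes "x \<in> roots" shows "long_root x \<or> short_root x"
  using assms
proof (induction rule: roots_induct)
  case (simple i)
  have "long_root (simple_root i0)" unfolding long_root_def using distinct
    by (intro exI[of _ 1] exI[of _ 0]) (simp add: norm4_def simple_root_nth)
  moreover have "long_root (simple_root i1)" unfolding long_root_def using distinct
    by (intro exI[of _ 0] exI[of _ 1]) (simp add: norm4_def simple_root_nth)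
  moreover have "short_root (simple_root i2)" unfolding short_root_def using distinct
    by (intro exI[of _ 0] exI[of _ 1]) (simp add: norm4_def simple_root_nth)
  ultimately have "\<forall>i. long_root (simple_root i) \<or> short_root (simple_root i)" unfolding all_iff by blast
  then show ?case by blast
qed (use long_root_reflection short_root_reflection in blast)

lemma long_root_cases:
  assumes "long_root x"
  obtains a b c :: int where "x $ i0 = a" "x $ i1 = b" "x $ i2 = sqrt 3 * c"
    "(2 * a - b = 2 \<or> 2 * a - b = - 2) \<and> 2 * c - b = 0 \<or>
     (2 * a - b = 1 \<or> 2 * a - b = - 1) \<and> (2 * c - b = 1 \<or> 2 * c - b = - 1)"
  using assms that norm4_cases unfolding long_root_def by blast

lemma short_root_cases:
  assumes "short_root x"
  obtains a b c :: int where "x $ i0 = sqrt 3 * a" "x $ i1 = sqrt 3 * b" "x $ i2 = c"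
    "(2 * c - 3 * b = 2 \<or> 2 * c - 3 * b = - 2) \<and> 2 * a - b = 0 \<or>
     (2 * c - 3 * b = 1 \<or> 2 * c - 3 * b = - 1) \<and> (2 * a - b = 1 \<or> 2 * a - b = - 1)"
  using assms that norm4_cases unfolding short_root_def by blast

definition neg :: "real ^ 'i \<Rightarrow> bool" where
  "neg x \<longleftrightarrow> (\<forall>i. x $ i \<le> 0)"

text \<open>The norm equation keeps the coordinates so close to a multiple of the null vector
  \<open>(1, 2, sqrt 3)\<close> that the integers behind them cannot have both signs.\<close>

lemma sign_coherent: assumes "x \<in> roots" shows "neg x \<or> (\<forall>i. x $ i \<ge> 0)"
  using long_or_short[OF assms]
proof
  assume "long_root x"
  then obtain a b c :: int where x: "x $ i0 = a" "x $ i1 = b" "x $ i2 = sqrt 3 * c"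
    and "(2 * a - b = 2 \<or> 2 * a - b = - 2) \<and> 2 * c - b = 0 \<or>
     (2 * a - b = 1 \<or> 2 * a - b = - 1) \<and> (2 * c - b = 1 \<or> 2 * c - b = - 1)"
    by (rule long_root_cases)
  then have "a \<le> 0 \<and> b \<le> 0 \<and> c \<le> 0 \<or> a \<ge> 0 \<and> b \<ge> 0 \<and> c \<ge> 0" by presburger
  then show ?thesis unfolding neg_def all_iff x by (auto simp: mult_le_0_iff)
next
  assume "short_root x"
  then obtain a b c :: int where x: "x $ i0 = sqrt 3 * a" "x $ i1 = sqrt 3 * b" "x $ i2 = c"
    and "(2 * c - 3 * b = 2 \<or> 2 * c - 3 * b = - 2) \<and> 2 * a - b = 0 \<or>
     (2 * c - 3 * b = 1 \<or> 2 * c - 3 * b = - 1) \<and> (2 * a - b = 1 \<or> 2 * a - b = - 1)"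
    by (rule short_root_cases)
  then have "a \<le> 0 \<and> b \<le> 0 \<and> c \<le> 0 \<or> a \<ge> 0 \<and> b \<ge> 0 \<and> c \<ge> 0" by presburger
  then show ?thesis unfolding neg_def all_iff x by (auto simp: mult_le_0_iff)
qed

lemma not_neg_nonneg: assumes "x \<in> roots" "\<forall>i. x $ i \<ge> 0" shows "\<not> neg x"
proof
  assume "neg x"
  then have "x $ i = 0" for i using assms(2) unfolding neg_def by (meson order_antisym)
  then show False using root_norm[OF assms(1)] by simp
qed

lemma simple_reflection_roots: "x \<in> roots \<Longrightarrow> simple_reflection i x \<in> roots"
  using act_roots[of "s i" x] act_s_mult[of \<one> i x] s_closed by simp

lemma simple_reflection_simple_root: "simple_reflection i (simple_root i) = - simple_root i"
  by (simp add: vec_eq_iff simple_reflection_nth B_simple_root_simple_root simple_root_nth)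

lemma neg_simple_root: "- simple_root i \<in> roots"
  using simple_reflection_roots[of "simple_root i" i] by (simp add: simple_reflection_simple_root)

text \<open>Only coordinate \<open>i\<close> changes. If the sign of the root changes, all other
  coordinates vanish, and norm 1 leaves only \<open>- simple_root i\<close>.\<close>

lemma neg_reflection:
  assumes x: "x \<in> roots" "neg x" "x \<noteq> - simple_root i"
  shows "neg (simple_reflection i x)"
proof (rule ccontr)
  assume "\<not> ?thesis"
  then have nn: "simple_reflection i x $ j \<ge> 0" for j
    using sign_coherent simple_reflection_roots x(1) by blast
  have zero: "x $ j = 0" if "j \<noteq> i" for j
    using nn[of j] x(2) that by (simp add: simple_reflection_nth neg_def order_antisym)
  have "\<forall>i. (\<forall>j. j \<noteq> i \<longrightarrow> x $ j = 0) \<longrightarrow> (x $ i)\<^sup>2 = 1"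
    unfolding all_iff using root_norm[OF x(1)] distinct by auto
  then have "(x $ i)\<^sup>2 = 1" using zero by blast
  moreover have "x $ i \<le> 0" using x(2) by (simp add: neg_def)
  ultimately have "x $ i = - 1" by (auto simp: power2_eq_1_iff)
  then have "x = - simple_root i" using zero by (auto simp: vec_eq_iff simple_root_nth)
  then show False using x(3) by blast
qed

text \<open>The linear form \<open>\<nu>\<close> measures the speed of a root along the glide axis of the Coxeter element
  \<open>s\<^sub>0 s\<^sub>2 s\<^sub>1\<close>; it vanishes on the roots whose wall is parallel to that axis.\<close>

abbreviation \<nu> :: "real ^ 'i \<Rightarrow> real" where
  "\<nu> x \<equiv> x $ i1 - (x $ i0 + sqrt 3 * x $ i2) / 2"

text \<open>\<open>\<nu> x\<close> equals \<open>B x (simple_root i1)\<close>. In the finite system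
  of type G2 only two opposite short roots are orthogonal to a given long root; each gives one
  progression with step \<open>- sqrt 3 * \<delta>\<close>.\<close>

lemma parallel_roots:
  assumes "x \<in> roots" "neg x" "\<nu> x = 0"
  obtains k :: nat where "x $ i0 = - sqrt 3 * k" "x $ i1 = - sqrt 3 * (1 + 2 * k)" "x $ i2 = - 2 - 3 * k"
  | k :: nat where "x $ i0 = - sqrt 3 * (1 + k)" "x $ i1 = - sqrt 3 * (1 + 2 * k)" "x $ i2 = - 1 - 3 * k"
  using long_or_short[OF assms(1)]
proof
  assume "long_root x"
  then obtain a b c :: int where x: "x $ i0 = a" "x $ i1 = b" "x $ i2 = sqrt 3 * c"
    and abc: "(2 * a - b = 2 \<or> 2 * a - b = - 2) \<and> 2 * c - b = 0 \<or>
     (2 * a - b = 1 \<or> 2 * a - b = - 1) \<and> (2 * c - b = 1 \<or> 2 * c - b = - 1)"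
    by (rule long_root_cases)
  have "sqrt 3 * (sqrt 3 * real_of_int c) = 3 * real_of_int c" by (rule sqrt_3_mult)
  moreover have "2 * real_of_int b = real_of_int a + sqrt 3 * (sqrt 3 * real_of_int c)"
    using assms(3) unfolding x by argo
  ultimately have "real_of_int (2 * b) = real_of_int (a + 3 * c)" by simp
  then have "2 * b = a + 3 * c" by (simp only: of_int_eq_iff)
  then have False using abc by presburger
  then show ?thesis ..
next
  assume "short_root x"
  then obtain a b c :: int where x: "x $ i0 = sqrt 3 * a" "x $ i1 = sqrt 3 * b" "x $ i2 = c"
    and abc: "(2 * c - 3 * b = 2 \<or> 2 * c - 3 * b = - 2) \<and> 2 * a - b = 0 \<or>
     (2 * c - 3 * b = 1 \<or> 2 * c - 3 * b = - 1) \<and> (2 * a - b = 1 \<or> 2 * a - b = - 1)"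
    by (rule short_root_cases)
  have "sqrt 3 * real_of_int (2 * b) = sqrt 3 * real_of_int (a + c)"
    using assms(3) unfolding x by (simp add: algebra_simps)
  then have eq: "2 * b = a + c" by (simp only: mult_cancel_left of_int_eq_iff) simp
  have neg: "a \<le> 0" "b \<le> 0" "c \<le> 0"
    using assms(2) unfolding neg_def all_iff x by (auto simp: mult_le_0_iff)
  have "\<exists>k. k \<ge> 0 \<and> (a = - k \<and> b = - 1 - 2 * k \<and> c = - 2 - 3 * k \<or>
      a = - 1 - k \<and> b = - 1 - 2 * k \<and> c = - 1 - 3 * k)"
  proof -
    have "b = 2 * a - 1 \<and> c = 3 * a - 2 \<or> b = 2 * a + 1 \<and> c = 3 * a + 2"
      using abc eq by auto
    then show ?thesis
    proof (elim disjE conjE)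
      assume "b = 2 * a - 1" "c = 3 * a - 2"
      then show ?thesis using neg by (intro exI[of _ "- a"]) auto
    next
      assume "b = 2 * a + 1" "c = 3 * a + 2"
      then show ?thesis using neg by (intro exI[of _ "- 1 - a"]) auto
    qed
  qed
  then obtain k where k: "k \<ge> 0" "a = - k \<and> b = - 1 - 2 * k \<and> c = - 2 - 3 * k \<or>
      a = - 1 - k \<and> b = - 1 - 2 * k \<and> c = - 1 - 3 * k" by blast
  then obtain k' where k': "k = int k'" using nonneg_int_cases by blast
  from k(2) show ?thesis
  proof (elim disjE conjE)
    assume abc: "a = - k" "b = - 1 - 2 * k" "c = - 2 - 3 * k"
    show thesis by (rule that(1)[of k']) (simp_all add: x abc k' algebra_simps)
  next
    assume abc: "a = - 1 - k" "b = - 1 - 2 * k" "c = - 1 - 3 * k"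
    show thesis by (rule that(2)[of k']) (simp_all add: x abc k' algebra_simps)
  qed
qed

text \<open>The null root, spanning the radical of \<open>B\<close>; its last coordinate is
  \<open>sqrt 3\<close> instead of the customary 3 because the short simple root has norm 1.\<close>

definition \<delta> :: "real ^ 'i" where
  "\<delta> = (\<chi> i. if i = i0 then 1 else if i = i1 then 2 else sqrt 3)"

lemma \<delta>_coords [simp]: "\<delta> $ i0 = 1" "\<delta> $ i1 = 2" "\<delta> $ i2 = sqrt 3"
  using distinct by (auto simp: \<delta>_def)

lemma act_\<delta>: assumes "w \<in> carrier W" shows "act w \<delta> = \<delta>"
proof -
  obtain us where us: "w = word_prod us" using ex_word assms by metis
  have "\<forall>i. simple_reflection i \<delta> = \<delta>"
    unfolding all_iff by (simp add: vec_eq_iff3 reflection_coords)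
  then have "foldr simple_reflection us \<delta> = \<delta>" by (induction us) auto
  then show ?thesis by (simp add: us act_word_prod)
qed

section \<open>Walls that separate a point from the convex set\<close>

definition sep :: "'a set \<Rightarrow> 'a \<Rightarrow> real ^ 'i \<Rightarrow> bool" where
  "sep L u x \<longleftrightarrow> x \<in> R L \<and> neg (act u x)"

lemma R_roots: "x \<in> R L \<Longrightarrow> x \<in> roots"
  by (simp add: R_def)

lemma R_combination:
  assumes L: "L \<subseteq> carrier W" and x: "x \<in> R L" and y: "y \<in> R L" and z: "z \<in> roots"
    and eq: "z = a *\<^sub>R x + b *\<^sub>R y + d *\<^sub>R \<delta>" and nonneg: "a \<ge> 0" "b \<ge> 0" "d \<ge> 0"
  shows "z \<in> R L"
  unfolding R_iff[OF L]
proof (intro conjI ballI z)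
  fix w assume w: "w \<in> L"
  then have wW: "w \<in> carrier W" using L by blast
  have "act w z = a *\<^sub>R act w x + b *\<^sub>R act w y + d *\<^sub>R \<delta>"
    unfolding eq using linear_act[OF wW] act_\<delta>[OF wW] by (simp add: linear_add linear_scale)
  moreover have "\<forall>i. act w x $ i \<ge> 0" "\<forall>i. act w y $ i \<ge> 0" using R_iff[OF L] x y w by auto
  moreover have "\<forall>i. \<delta> $ i \<ge> 0" unfolding all_iff by simp
  ultimately show "\<forall>i. act w z $ i \<ge> 0" using nonneg by (auto intro!: add_nonneg_nonneg)
qed

text \<open>\<open>simple_root i\<close> is the only positive root that its reflection makes
  negative. So the wall of \<open>x\<close> could be crossed the wrong way only if \<open>x\<close>
  is the very root tested by the toggle, and then the step is refused.\<close>

lemma sep_toggle: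
  assumes u: "u \<in> carrier W" and sep: "sep L (toggle L i u) x" shows "sep L u x"
proof (rule ccontr)
  assume not_sep: "\<not> sep L u x"
  have x: "x \<in> R L" "x \<in> roots" using sep R_roots by (auto simp: sep_def)
  then have not_neg: "\<not> neg (act u x)" using not_sep by (simp add: sep_def)
  then have "toggle L i u \<noteq> u" using sep by (auto simp: sep_def)
  then have tog: "toggle L i u = s i \<otimes> u" "act (inv u) (simple_root i) \<notin> R L"
    by (auto simp: toggle_def split: if_splits)
  define y where "y = simple_reflection i (act u x)"
  have y: "y \<in> roots" "neg y" using sep tog(1) u x act_roots simple_reflection_roots
    by (auto simp: y_def sep_def act_s_mult)
  have "act u x = simple_reflection i y" by (simp add: y_def)
  then have "y = - simple_root i" using neg_reflection[OF y] not_neg by metis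
  then have "act u x = simple_root i"
    using \<open>act u x = simple_reflection i y\<close> simple_reflection_invol[of i "simple_root i"]
    by (simp add: simple_reflection_simple_root)
  then have "x = act (inv u) (simple_root i)" using act_inv(1)[OF u, of x] by simp
  then show False using x tog(2) by simp
qed

text \<open>The reflected root is \<open>x\<close> plus a nonnegative multiple of the root that
  caused the refusal, hence lies in \<open>R L\<close>. It could turn positive only if these two
  roots were opposite, which a point of \<open>L\<close> excludes.\<close>

lemma sep_reflected:
  assumes L: "L \<subseteq> carrier W" "L \<noteq> {}" and u: "u \<in> carrier W" and sep: "sep L u x"
    and stays: "act (inv u) (simple_root i) \<in> R L" and le: "B (act u x) (simple_root i) \<le> 0"
  shows "\<exists>x'. sep L u x' \<and> act u x' = simple_reflection i (act u x)"
proof -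
  define y where "y = act (inv u) (simple_root i)"
  define z where "z = act (inv u) (simple_reflection i (act u x))"
  have iu: "inv u \<in> carrier W" using u by simp
  have x: "x \<in> R L" "x \<in> roots" "neg (act u x)" using sep R_roots by (auto simp: sep_def)
  have z: "z \<in> roots" using x(2) u by (simp add: z_def act_roots simple_reflection_roots)
  have actz: "act u z = simple_reflection i (act u x)" using u by (simp add: z_def)
  have "z = 1 *\<^sub>R x + (- 2 * B (act u x) (simple_root i)) *\<^sub>R y + 0 *\<^sub>R \<delta>"
    unfolding z_def simple_reflection_def y_def using u linear_act[OF iu]
    by (simp add: linear_diff linear_scale)
  from R_combination[OF L(1) x(1) _ z this] have zR: "z \<in> R L" using stays le by (simp add: y_def)
  have "act u x \<noteq> - simple_root i"
  proof
    assume "act u x = - simple_root i"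
    then have xy: "x = - y" using act_inv(1)[OF u, of x] linear_neg[OF linear_act[OF iu]]
      by (simp add: y_def)
    obtain w where w: "w \<in> L" using L(2) by blast
    then have wW: "w \<in> carrier W" using L(1) by blast
    have "\<forall>i. act w x $ i \<ge> 0" "\<forall>i. act w y $ i \<ge> 0"
      using R_iff[OF L(1)] x(1) stays w by (auto simp: y_def)
    moreover have "act w x = - act w y" using xy linear_neg[OF linear_act[OF wW]] by simp
    ultimately have "neg (act w x)" by (simp add: neg_def)
    then show False using not_neg_nonneg \<open>\<forall>i. act w x $ i \<ge> 0\<close> act_roots[OF wW x(2)] by blast
  qed
  then have "neg (act u z)" using neg_reflection[OF act_roots[OF u x(2)] x(3)] actz by simp
  then show ?thesis using zR actz by (auto simp: sep_def)
qed

lemma toggle_cases: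
  obtains "toggle L i u = u" "act (inv u) (simple_root i) \<in> R L" | "toggle L i u = s i \<otimes> u"
proof (cases "act (inv u) (simple_root i) \<in> R L")
  case True
  then show thesis using that(1) by (simp add: toggle_def)
next
  case False
  then show thesis using that(2) by (simp add: toggle_def)
qed

lemma sep_toggle_step:
  assumes L: "L \<subseteq> carrier W" "L \<noteq> {}" and u: "u \<in> carrier W" and sep: "sep L u x"
    and persist: "\<And>x. sep L u x \<Longrightarrow> sep L (toggle L i u) x"
  shows "\<exists>x'. sep L (toggle L i u) x' \<and> (act (toggle L i u) x' = simple_reflection i (act u x) \<or>
    act (toggle L i u) x' = act u x \<and> B (act u x) (simple_root i) \<ge> 0)"
proof (cases rule: toggle_cases[of L i u])
  case 1
  then show ?thesis using sep sep_reflected[OF L u sep 1(2)]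
    by (cases "B (act u x) (simple_root i) \<ge> 0") auto
next
  case 2
  then show ?thesis using persist[OF sep] u by (auto simp: act_s_mult)
qed

end

section \<open>Periodic orbits in affine type G2\<close>

text \<open>Up to rotation every ordering is \<open>i1\<close> followed by \<open>i0\<close> and
  \<open>i2\<close> in some order. The states \<open>y\<close>, \<open>z\<close>, \<open>v\<close>
  precede the three toggles of a round.\<close>

locale g2_orbit = g2_system W s i0 i1 i2
  for W (structure) and s :: "'i::finite \<Rightarrow> 'a" and i0 i1 i2 +
  fixes L :: "'a set" and y z v :: "nat \<Rightarrow> 'a" and a b :: 'i and K :: nat
  assumes L: "L \<subseteq> carrier W" "L \<noteq> {}"
    and y_closed: "y j \<in> carrier W"
    and ab: "a = i0 \<and> b = i2 \<or> a = i2 \<and> b = i0"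
    and z_eq: "z j = toggle L i1 (y j)"
    and v_eq: "v j = toggle L a (z j)"
    and y_Suc: "y (Suc j) = toggle L b (v j)"
    and K: "K > 0" "y (j + K) = y j"
begin

lemma z_closed: "z j \<in> carrier W" and v_closed: "v j \<in> carrier W"
  using y_closed by (simp_all add: z_eq v_eq)

lemma sep_y_Suc: assumes "sep L (y (Suc j)) x" shows "sep L (v j) x" "sep L (z j) x" "sep L (y j) x"
proof -
  show 1: "sep L (v j) x" using sep_toggle[OF v_closed[of j], where i = b and x = x and L = L] assms by (simp add: y_Suc)
  show 2: "sep L (z j) x" using sep_toggle[OF z_closed[of j], where i = a and x = x and L = L] 1 by (simp add: v_eq)
  show "sep L (y j) x" using sep_toggle[OF y_closed[of j], where i = i1 and x = x and L = L] 2 by (simp add: z_eq)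
qed

text \<open>Separation passes backwards along the orbit, and by periodicity \<open>y j\<close>
  recurs after time \<open>j + l\<close>.\<close>

lemma sep_y_later: assumes "sep L (y j) x" shows "sep L (y (j + l)) x"
proof -
  have down: "sep L (y (j + l)) x" if "sep L (y (j + l + r)) x" for r
    using that by (induction r) (auto dest: sep_y_Suc)
  have per: "y (j + l + r * K) = y (j + l)" for l r
    by (induction r) (auto simp: K(2) add.assoc[symmetric] add.commute[of K])
  have "y (j + l * K) = y j" using per[of 0 l] by simp
  then have "sep L (y (j + l + (l * K - l))) x" using assms K(1) by simp
  then show ?thesis by (rule down)
qed

lemma sep_persist:
  assumes "sep L (y j) x"
  shows "sep L (z j) x" "sep L (v j) x" "sep L (y (Suc j)) x"
  using sep_y_later[OF assms, of 1] sep_y_Suc by auto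

lemma sep_from_z: assumes "sep L (z j) x" shows "sep L (v j) x" "sep L (y (Suc j)) x"
proof -
  have "sep L (y j) x" using sep_toggle[OF y_closed[of j], where i = i1 and x = x and L = L] assms by (simp add: z_eq)
  then show "sep L (v j) x" "sep L (y (Suc j)) x" by (rule sep_persist)+
qed

lemma sep_from_v: assumes "sep L (v j) x" shows "sep L (y (Suc j)) x"
proof -
  have "sep L (z j) x" using sep_toggle[OF z_closed[of j], where i = a and x = x and L = L] assms by (simp add: v_eq)
  then show ?thesis by (rule sep_from_z)
qed

text \<open>The reflection at \<open>i1\<close> fixes \<open>p\<close> and sends \<open>q\<close> to
  \<open>2 * p - q\<close>; those at \<open>i0\<close> and \<open>i2\<close> together fix
  \<open>q\<close> and send \<open>p\<close> to \<open>2 * q - p\<close>. A full round thus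
  preserves \<open>\<nu> = q - p\<close> and lowers both \<open>p\<close> and \<open>q\<close> by
  \<open>2 * \<nu>\<close>.\<close>

abbreviation q :: "real ^ 'i \<Rightarrow> real" where "q x \<equiv> x $ i1"

abbreviation p :: "real ^ 'i \<Rightarrow> real" where "p x \<equiv> (x $ i0 + sqrt 3 * x $ i2) / 2"

text \<open>The inequality absorbs refusals: a reflection is omitted only at a nonnegative pairing,
  where the unreflected coordinate is at least the reflected one.\<close>

lemma from_z:
  assumes "sep L (z j) x"
  shows "\<exists>x'. sep L (y (Suc j)) x' \<and> q (act (y (Suc j)) x') = q (act (z j) x) \<and>
    p (act (y (Suc j)) x') \<ge> 2 * q (act (z j) x) - p (act (z j) x)"
proof -
  obtain x1 where x1: "sep L (v j) x1" "act (v j) x1 = simple_reflection a (act (z j) x) \<or>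
      act (v j) x1 = act (z j) x \<and> B (act (z j) x) (simple_root a) \<ge> 0"
    using sep_toggle_step[OF L z_closed assms, of a, folded v_eq] sep_from_z by blast
  obtain x2 where x2: "sep L (y (Suc j)) x2" "act (y (Suc j)) x2 = simple_reflection b (act (v j) x1) \<or>
      act (y (Suc j)) x2 = act (v j) x1 \<and> B (act (v j) x1) (simple_root b) \<ge> 0"
    using sep_toggle_step[OF L v_closed x1(1), of b, folded y_Suc] sep_from_v by blast
  define X X1 X2 where "X = act (z j) x" and "X1 = act (v j) x1" and "X2 = act (y (Suc j)) x2"
  note eqs = X_def[symmetric] X1_def[symmetric] X2_def[symmetric]
  have X1: "X1 = simple_reflection a X \<or> X1 = X \<and> B X (simple_root a) \<ge> 0" using x1(2) unfolding eqs .
  have X2: "X2 = simple_reflection b X1 \<or> X2 = X1 \<and> B X1 (simple_root b) \<ge> 0" using x2(2) unfolding eqs .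
  have "X2 $ i1 = X $ i1 \<and> X2 $ i0 \<ge> X $ i1 - X $ i0 \<and> X2 $ i2 \<ge> sqrt 3 * X $ i1 - X $ i2"
    using ab X1 X2 by (auto simp: reflection_coords B_simple_root_coords)
  moreover have "sqrt 3 * (sqrt 3 * X $ i1 - X $ i2) = 3 * X $ i1 - sqrt 3 * X $ i2"
    by (simp add: right_diff_distrib sqrt_3_mult)
  moreover from calculation have "sqrt 3 * (sqrt 3 * X $ i1 - X $ i2) \<le> sqrt 3 * X2 $ i2"
    by (intro mult_left_mono) auto
  ultimately have "q X2 = q X" "p X2 \<ge> 2 * q X - p X" by argo+
  then show ?thesis using x2(1) unfolding X_def X2_def by (intro exI[of _ x2] conjI)
qed

text \<open>If \<open>d = p - q > 0\<close>, the pairing with \<open>simple_root i1\<close> is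
  negative, so this reflection is never omitted. It raises \<open>q\<close> by at least
  \<open>2 * d\<close>, and \<open>from_z\<close> preserves the gap; but \<open>q\<close> cannot
  become positive on negative roots.\<close>

lemma not_approaching:
  assumes sep: "sep L (y j) x" shows "\<nu> (act (y j) x) \<ge> 0"
proof (rule ccontr)
  define d where "d = p (act (y j) x) - q (act (y j) x)"
  assume "\<not> ?thesis"
  then have d: "d > 0" by (simp add: d_def)
  have "\<exists>x'. sep L (y (j + l)) x' \<and> q (act (y (j + l)) x') \<ge> q (act (y j) x) + l * d \<and>
      p (act (y (j + l)) x') - q (act (y (j + l)) x') \<ge> d" for l
  proof (induction l)
    case 0
    then show ?case using sep by (auto simp: d_def)
  next
    case (Suc l)
    then obtain x' where x': "sep L (y (j + l)) x'" "q (act (y (j + l)) x') \<ge> q (act (y j) x) + l * d"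
      "p (act (y (j + l)) x') - q (act (y (j + l)) x') \<ge> d" by blast
    define X where "X = act (y (j + l)) x'"
    have "B X (simple_root i1) < 0" using x'(3) d unfolding B_simple_root_coords X_def by linarith
    then obtain x1 where x1: "sep L (z (j + l)) x1" "act (z (j + l)) x1 = simple_reflection i1 X"
      using sep_toggle_step[OF L y_closed x'(1), of i1, folded z_eq X_def] sep_persist
      by (meson not_le)
    obtain x2 where x2: "sep L (y (Suc (j + l))) x2"
      "q (act (y (Suc (j + l))) x2) = q (act (z (j + l)) x1)"
      "p (act (y (Suc (j + l))) x2) \<ge> 2 * q (act (z (j + l)) x1) - p (act (z (j + l)) x1)"
      using from_z[OF x1(1)] by blast
    have "q (act (z (j + l)) x1) = 2 * p X - q X" "p (act (z (j + l)) x1) = p X"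
      unfolding x1(2) by (simp_all add: reflection_coords)
    moreover have "real (Suc l) * d = real l * d + d" by (simp add: algebra_simps)
    ultimately have "q (act (y (Suc (j + l))) x2) \<ge> q (act (y j) x) + real (Suc l) * d"
      "p (act (y (Suc (j + l))) x2) - q (act (y (Suc (j + l))) x2) \<ge> d"
      using x2(2,3) x'(2,3)[folded X_def] d by linarith+
    then show ?case using x2(1) by auto
  qed
  moreover obtain l :: nat where "- q (act (y j) x) < l * d" using d reals_Archimedean3 by blast
  ultimately obtain x' where "sep L (y (j + l)) x'" "q (act (y (j + l)) x') > 0" by fastforce
  then show False by (auto simp: sep_def neg_def not_le[symmetric])
qed

text \<open>With \<open>\<nu>\<close> nonnegative at every round, \<open>q\<close> of the fixed root
  \<open>x\<close> cannot increase and is therefore constant on the periodic orbit. If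
  \<open>\<nu>\<close> is positive, the toggle at \<open>i1\<close> must then be refused, and the
  rest of the round yields a separating root with negative \<open>\<nu>\<close>.\<close>

lemma parallel:
  assumes sep: "sep L (y j) x" shows "\<nu> (act (y j) x) = 0"
proof (rule ccontr)
  assume "\<not> ?thesis"
  then have pos: "\<nu> (act (y j) x) > 0" using not_approaching[OF sep] by simp
  have q_Suc: "q (act (y (Suc l)) x) = q (act (z l) x)" for l
    using ab distinct y_closed z_closed v_closed
    by (auto simp: y_Suc v_eq toggle_def act_s_mult reflection_coords z_closed v_closed)
  have q_z: "q (act (z l) x) = (if z l = y l then q (act (y l) x) else 2 * p (act (y l) x) - q (act (y l) x))" for l
    using y_closed[of l] by (auto simp: z_eq toggle_def act_s_mult reflection_coords)
  have decr: "q (act (y (Suc (j + l))) x) \<le> q (act (y (j + l)) x)" for l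
    using not_approaching[OF sep_y_later[OF sep, of l]] by (auto simp: q_Suc q_z)
  have "q (act (y (Suc j + l)) x) \<le> q (act (y (Suc j)) x)" for l
  proof (induction l)
    case (Suc l)
    then show ?case using decr[of "Suc l"] by simp
  qed simp
  from this[of "K - 1"] have "q (act (y j) x) \<le> q (act (y (Suc j)) x)" using K by simp
  then have stay: "z j = y j" using pos by (auto simp: q_Suc q_z split: if_splits)
  obtain x' where x': "sep L (y (Suc j)) x'" "q (act (y (Suc j)) x') = q (act (z j) x)"
    "p (act (y (Suc j)) x') \<ge> 2 * q (act (z j) x) - p (act (z j) x)"
    using from_z[OF sep_persist(1)[OF sep]] by blast
  then have "\<nu> (act (y (Suc j)) x') < 0" using pos unfolding stay by argo
  then show False using not_approaching[OF x'(1)] by simp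
qed

text \<open>A refusal puts the root tested at \<open>i1\<close> into \<open>R L\<close>. Modulo
  \<open>\<delta>\<close> it is perpendicular to the separating root, and a long root lies between
  them at 60 and 30 degrees; hence the coefficients 1/2 and \<open>sqrt 3 / 2\<close>. That root has
  \<open>\<nu>\<close> equal to 1/2, against \<open>parallel\<close>.\<close>

lemma crosses_i1:
  assumes sep: "sep L (y j) x" shows "z j = s i1 \<otimes> y j"
proof (cases rule: toggle_cases[of L i1 "y j"])
  case 1
  define u X where "u = y j" and "X = act u x"
  have u: "u \<in> carrier W" "inv u \<in> carrier W" using y_closed by (auto simp: u_def)
  have x: "x \<in> R L" "x \<in> roots" "neg X" using sep R_roots by (auto simp: sep_def u_def X_def)
  have "X \<in> roots" using x(2) u by (simp add: X_def act_roots)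
  have impossible: False
    if t: "t \<in> roots" "neg t" "\<nu> t \<noteq> 0" and d: "d \<ge> 0"
      and eq: "t = (sqrt 3 / 2) *\<^sub>R X + (1 / 2) *\<^sub>R simple_root i1 + d *\<^sub>R \<delta>" for t d
  proof -
    have "act (inv u) t = (sqrt 3 / 2) *\<^sub>R x + (1 / 2) *\<^sub>R act (inv u) (simple_root i1) + d *\<^sub>R \<delta>"
      unfolding eq X_def using linear_act[OF u(2)] act_\<delta>[OF u(2)] u(1) by (simp add: linear_add linear_scale)
    from R_combination[OF L(1) x(1) _ _ this] have "act (inv u) t \<in> R L"
      using 1(2) d t(1) u act_roots by (simp add: u_def)
    then have "sep L u (act (inv u) t)" using t(2) u by (simp add: sep_def)
    then have "\<nu> (act u (act (inv u) t)) = 0" using parallel unfolding u_def by blast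
    then show False using t(3) u by simp
  qed
  have half: "sqrt 3 / 2 * (- sqrt 3 * r) = - 3 / 2 * r" for r
    by (simp flip: mult.assoc)
  have "\<nu> X = 0" using parallel[OF sep] by (simp add: X_def u_def)
  from parallel_roots[OF \<open>X \<in> roots\<close> x(3) this] have False
  proof cases
    case (1 k)
    \<comment> \<open>The last negative root in its class modulo \<open>\<delta>\<close>; the
      multiple of \<open>\<delta>\<close> below is the one that leads to it.\<close>
    define t where "t = simple_reflection i2 (- simple_root i1)"
    have t: "t $ i0 = 0" "t $ i1 = - 1" "t $ i2 = - sqrt 3"
      using distinct by (auto simp: t_def reflection_coords simple_root_nth)
    show False
    proof (rule impossible)
      show "t \<in> roots" unfolding t_def by (intro simple_reflection_roots neg_simple_root)
      show "neg t" unfolding neg_def all_iff t by simp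
      show "\<nu> t \<noteq> 0" unfolding t by simp
      show "3 / 2 * real k \<ge> 0" by simp
      show "t = (sqrt 3 / 2) *\<^sub>R X + (1 / 2) *\<^sub>R simple_root i1 + (3 / 2 * real k) *\<^sub>R \<delta>"
        unfolding vec_eq_iff3 using distinct
        by (simp add: t 1 half simple_root_nth algebra_simps)
    qed
  next
    case (2 k)
    show False
    proof (rule impossible)
      show "- simple_root i0 \<in> roots" by (rule neg_simple_root)
      show "neg (- simple_root i0)" by (simp add: neg_def simple_root_nth)
      show "\<nu> (- simple_root i0) \<noteq> 0" using distinct by (simp add: simple_root_nth)
      show "1 / 2 + 3 / 2 * real k \<ge> 0" by simp
      show "- simple_root i0 = (sqrt 3 / 2) *\<^sub>R X + (1 / 2) *\<^sub>R simple_root i1 + (1 / 2 + 3 / 2 * real k) *\<^sub>R \<delta>"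
        unfolding vec_eq_iff3 using distinct
        by (simp add: 2 half simple_root_nth algebra_simps)
    qed
  qed
  then show ?thesis ..
qed (simp add: z_eq)

text \<open>The pairings with \<open>simple_root i0\<close> and \<open>simple_root i2\<close> have
  opposite signs, so performing just one of these reflections destroys \<open>\<nu> = 0\<close>. If
  both toggles are refused, the reflection with negative pairing can still be applied to the root,
  with the same contradiction.\<close>

lemma crosses_ab:
  assumes sep: "sep L (y j) x" shows "v j = s a \<otimes> z j \<and> y (Suc j) = s b \<otimes> v j"
proof -
  define X where "X = act (z j) x"
  have sep_z: "sep L (z j) x" using sep_persist[OF sep] by blast
  have X: "X \<in> roots" using sep_z z_closed act_roots R_roots by (auto simp: X_def sep_def)
  have zy: "X = simple_reflection i1 (act (y j) x)"
    unfolding X_def crosses_i1[OF sep] using y_closed by (simp add: act_s_mult)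
  have nu: "\<nu> X = 0" using parallel[OF sep] unfolding zy by (simp add: reflection_coords)
  have sum_0: "B X (simple_root i0) + sqrt 3 * B X (simple_root i2) = 0"
    using nu by (simp add: B_simple_root_coords right_diff_distrib sqrt_3_mult)
  \<comment> \<open>Otherwise \<open>X\<close> is orthogonal to all simple roots and has norm
    0.\<close>
  have nz: "B X (simple_root i0) \<noteq> 0"
  proof
    assume "B X (simple_root i0) = 0"
    then have X0: "X $ i0 = X $ i1 / 2" and X2: "sqrt 3 * X $ i2 = 3 / 2 * X $ i1"
      using nu by (auto simp: B_simple_root_coords)
    have "3 * (X $ i2)\<^sup>2 = (sqrt 3 * X $ i2)\<^sup>2" by (simp add: power_mult_distrib)
    then have "(X $ i2)\<^sup>2 = 3 / 4 * (X $ i1)\<^sup>2" unfolding X2 by (simp add: power2_eq_square)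
    moreover have "sqrt 3 * X $ i1 * X $ i2 = 3 / 2 * (X $ i1)\<^sup>2"
      using arg_cong[OF X2, of "\<lambda>t. X $ i1 * t"] by (simp add: power2_eq_square algebra_simps)
    moreover have "(X $ i1 / 2)\<^sup>2 = (X $ i1)\<^sup>2 / 4" "X $ i1 / 2 * X $ i1 = (X $ i1)\<^sup>2 / 2"
      by (auto simp: power2_eq_square)
    ultimately show False using root_norm[OF X] unfolding X0 by linarith
  qed
  have ab': "B X (simple_root a) < 0 \<or> B X (simple_root b) < 0"
  proof (rule ccontr)
    assume "\<not> ?thesis"
    then have "B X (simple_root i0) \<ge> 0" "sqrt 3 * B X (simple_root i2) \<ge> 0" using ab by auto
    then show False using nz sum_0 by linarith
  qed
  have nu_0: "\<nu> (simple_reflection i0 X) = B X (simple_root i0)"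
    using nu unfolding reflection_coords B_simple_root_coords by argo
  have nu_2: "\<nu> (simple_reflection i2 X) = - B X (simple_root i0)"
    using nu unfolding reflection_coords B_simple_root_coords right_diff_distrib sqrt_3_mult by argo
  have nu_refl: "\<nu> (simple_reflection a X) \<noteq> 0" "\<nu> (simple_reflection b X) \<noteq> 0"
    using ab by (elim disjE conjE;
        simp only: nu_0 nu_2 neg_equal_0_iff_equal nz not_False_eq_True)+
  have final: "\<nu> (act (y (Suc j)) x) = 0" by (rule parallel[OF sep_persist(3)[OF sep]])
  show ?thesis
  proof (cases rule: toggle_cases[of L a "z j"])
    case 1
    then have v: "v j = z j" by (simp add: v_eq)
    show ?thesis
    proof (cases rule: toggle_cases[of L b "v j"])
      case b: 1
      have yz: "y (Suc j) = z j" using b v by (simp add: y_Suc)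
      have "\<exists>i\<in>{a, b}. B X (simple_root i) \<le> 0 \<and> act (inv (z j)) (simple_root i) \<in> R L"
        using ab' 1(2) b(2) v by (auto intro: less_imp_le)
      then obtain i where i: "i \<in> {a, b}" "B X (simple_root i) \<le> 0" "act (inv (z j)) (simple_root i) \<in> R L"
        by blast
      obtain x' where "sep L (z j) x'" "act (z j) x' = simple_reflection i X"
        using sep_reflected[OF L z_closed sep_z i(3)] i(2) unfolding X_def by blast
      then have "\<nu> (simple_reflection i X) = 0" using parallel[of "Suc j" x'] yz by (simp only:)
      then show ?thesis using nu_refl i(1) by blast
    next
      case 2
      then have "act (y (Suc j)) x = simple_reflection b X"
        using z_closed by (simp add: y_Suc v act_s_mult X_def)
      then show ?thesis using final nu_refl by (simp only:)
    qed
  next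
    case a: 2
    show ?thesis
    proof (cases rule: toggle_cases[of L b "v j"])
      case 1
      then have "act (y (Suc j)) x = simple_reflection a X"
        using z_closed a by (simp add: y_Suc v_eq act_s_mult X_def)
      then show ?thesis using final nu_refl by (simp only:)
    next
      case 2
      then show ?thesis using a by (simp add: v_eq y_Suc)
    qed
  qed
qed

theorem not_sep: "\<not> sep L (y 0) x"
proof
  assume "sep L (y 0) x"
  then have sep: "sep L (y j) x" for j using sep_y_later[of 0 x j] by simp
  \<comment> \<open>The separating root \<open>x\<close> has \<open>\<nu> = 0\<close> and shows no
    drift; \<open>r\<close> has \<open>\<nu> = 1\<close>, so each round lowers its \<open>q\<close>
    by 2.\<close>
  define r where "r = act (inv (y 0)) (simple_root i1)"
  have start: "act (y 0) r = simple_root i1" using y_closed by (simp add: r_def)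
  have "q (act (y j) r) = 1 - 2 * real j \<and> p (act (y j) r) = - 2 * real j" for j
  proof (induction j)
    case 0
    then show ?case using distinct by (simp add: start simple_root_nth)
  next
    case (Suc j)
    have "y (Suc j) = s b \<otimes> (s a \<otimes> (s i1 \<otimes> y j))"
      using crosses_ab[OF sep] crosses_i1[OF sep] by simp
    then have eq: "act (y (Suc j)) r = simple_reflection b (simple_reflection a (simple_reflection i1 (act (y j) r)))"
      using y_closed s_closed by (simp add: act_s_mult)
    show ?case using ab Suc unfolding eq
      by (auto simp: reflection_coords right_diff_distrib distrib_left sqrt_3_mult field_simps)
  qed
  from this[of K] have "q (act (y 0) r) = 1 - 2 * real K" using K(2)[of 0] by simp
  then show False using K(1) by (simp add: start simple_root_nth)
qed

end

context g2_system begin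

theorem futuristic: futuristic
  unfolding futuristic_def
proof (intro allI impI)
  fix L g assume asm: "convex_subset L \<and> L \<noteq> {} \<and> coxeter_element g"
  then have LW: "L \<subseteq> carrier W" unfolding convex_subset_def by auto
  show "heavy L g"
  proof (rule heavyI)
    show "convex_subset L" using asm by blast
    fix "is" u K x
    assume "is": "distinct is" "set is = UNIV" and u: "u \<in> carrier W" and K: "K > 0"
      and per: "\<And>t. orbit L is u (t + K * length is) = orbit L is u t" and x: "x \<in> R L"
    have len: "length is = 3"
    proof -
      have "card {i0, i1, i2} = length is" using "is" UNIV_eq distinct_card by metis
      then show ?thesis using distinct by simp
    qed
    obtain t where t: "t < 3" "is ! t = i1" using "is"(2) len by (metis UNIV_I in_set_conv_nth)
    define a b where "a = is ! ((t + 1) mod 3)" and "b = is ! ((t + 2) mod 3)"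
    have "a \<noteq> i1" "b \<noteq> i1" "a \<noteq> b"
    proof -
      have "(t + 1) mod 3 \<noteq> t" "(t + 2) mod 3 \<noteq> t" "(t + 1) mod 3 \<noteq> (t + 2) mod 3"
        using t(1) by presburger+
      then show "a \<noteq> i1" "b \<noteq> i1" "a \<noteq> b"
        unfolding a_def b_def t(2)[symmetric] using t(1) len "is"(1) by (auto simp: nth_eq_iff_index_eq)
    qed
    then have ab: "a = i0 \<and> b = i2 \<or> a = i2 \<and> b = i0"
      using UNIV_eq by (metis UNIV_I empty_iff insert_iff)
    have idx: "(t + 3 * j) mod 3 = t" "(t + 3 * j + 1) mod 3 = (t + 1) mod 3"
      "(t + 3 * j + 2) mod 3 = (t + 2) mod 3" for j
      using t(1) by presburger+
    interpret g2_orbit W s i0 i1 i2 L "\<lambda>j. orbit L is u (t + 3 * j)" "\<lambda>j. orbit L is u (t + 3 * j + 1)"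
      "\<lambda>j. orbit L is u (t + 3 * j + 2)" a b K
    proof
      show "L \<subseteq> carrier W" "L \<noteq> {}" "0 < K" using LW asm K by auto
      show "a = i0 \<and> b = i2 \<or> a = i2 \<and> b = i0" by (rule ab)
      fix j
      show "orbit L is u (t + 3 * j) \<in> carrier W" using u by simp
      show "orbit L is u (t + 3 * j + 1) = toggle L i1 (orbit L is u (t + 3 * j))"
        using idx[of j] t len by simp
      show "orbit L is u (t + 3 * j + 2) = toggle L a (orbit L is u (t + 3 * j + 1))"
        using idx(2)[of j] len by (simp add: a_def)
      have "t + 3 * Suc j = Suc (t + 3 * j + 2)" by simp
      then show "orbit L is u (t + 3 * Suc j) = toggle L b (orbit L is u (t + 3 * j + 2))"
        using idx(3)[of j] len by (simp only: orbit.simps b_def)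
      show "orbit L is u (t + 3 * (j + K)) = orbit L is u (t + 3 * j)"
        using per[of "t + 3 * j"] len by (simp add: algebra_simps)
    qed
    have earlier: "sep L (orbit L is u (t1 + r)) x \<Longrightarrow> sep L (orbit L is u t1) x" for t1 r
    proof (induction r)
      case (Suc r)
      then show ?case using sep_toggle[of "orbit L is u (t1 + r)"] u by simp
    qed simp
    have "\<not> sep L u x"
    proof
      assume "sep L u x"
      \<comment> \<open>\<open>u\<close> recurs at time \<open>K * 3\<close>, which is after time
        \<open>t\<close>, the first turn of \<open>i1\<close>; \<open>earlier\<close> leads back to
        that time.\<close>
      then have "sep L (orbit L is u (t + (K * 3 - t))) x"
        using per[of 0] K t(1) len by simp
      then show False using earlier[of t] not_sep[of x] by simp
    qed
    then have "\<not> neg (act u x)" using x by (simp add: sep_def)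
    then show "act u x \<in> positive_roots"
      using sign_coherent[OF act_roots[OF u R_roots[OF x]]] u R_roots[OF x] by (simp add: positive_roots_act)
  qed
qed

end

section \<open>Realizing the three types from their Coxeter graphs\<close>

context coxeter_system begin

lemma m_of_edge:
  assumes "({i, j}, l) \<in> coxeter_graph" shows "m i j = l"
  using assms m_sym unfolding coxeter_graph_def by (auto simp: doubleton_eq_iff)

lemma m_of_non_edge:
  assumes "i \<noteq> j" "\<And>l. ({i, j}, l) \<notin> coxeter_graph" shows "m i j = 2"
proof -
  have "\<not> m i j \<ge> 3" using assms unfolding coxeter_graph_def by blast
  then have "m i j < enat 3" by (simp add: numeral_eq_enat)
  then obtain k where k: "m i j = enat k" "k < 3" by (metis enat_iless enat_ord_simps(2))
  moreover have "k \<noteq> 0" "k \<noteq> 1"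
    using m_nonzero[of i j] m_eq_1_iff[of i j] assms(1) k(1) by (auto simp: zero_enat_def one_enat_def)
  ultimately show ?thesis by (simp add: numeral_eq_enat)
qed

lemma B_simple_of_m:
  "m i j = 2 \<Longrightarrow> B_simple i j = 0"
  "m i j = 3 \<Longrightarrow> B_simple i j = - 1 / 2"
  "m i j = 4 \<Longrightarrow> B_simple i j = - sqrt 2 / 2"
  "m i j = 6 \<Longrightarrow> B_simple i j = - sqrt 3 / 2"
  "m i j = \<infinity> \<Longrightarrow> B_simple i j = - 1"
  by (simp_all add: B_simple_def numeral_eq_enat cos_60 cos_45 cos_30)

lemma crystallographic:
  assumes "\<And>e l. (e, l) \<in> coxeter_graph \<Longrightarrow> l \<in> {3, 4, 6, \<infinity>}"
  shows "crystallographic_coxeter_system W s"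
proof
  fix i j
  consider "i = j" | l where "({i, j}, l) \<in> coxeter_graph" | "i \<noteq> j" "\<And>l. ({i, j}, l) \<notin> coxeter_graph"
    by blast
  then show "m i j \<in> {1, 2, 3, 4, 6, \<infinity>}"
  proof cases
    case 1
    then show ?thesis by (simp add: m_self)
  next
    case 2
    then show ?thesis using assms m_of_edge by blast
  next
    case 3
    then show ?thesis using m_of_non_edge by blast
  qed
qed

lemma futuristic_G2_tilde: assumes type_G2_tilde shows futuristic
proof -
  obtain v where v: "bij_betw v {..<3::nat} UNIV"
    and graph: "coxeter_graph = {({v 0, v 1}, 3), ({v 1, v 2}, 6)}"
    using assms unfolding type_G2_tilde_def by blast
  interpret crystallographic_coxeter_system W s
    by (rule crystallographic) (auto simp: graph)
  have inj: "v i = v j \<longleftrightarrow> i = j" if "i < 3" "j < 3" for i j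
    using v that unfolding bij_betw_def inj_on_def by auto
  have ne: "v 0 \<noteq> v 1" "v 1 \<noteq> v 2" "v 0 \<noteq> v 2" by (simp_all add: inj)
  interpret g2_system W s "v 0" "v 1" "v 2"
  proof
    have "{..<3::nat} = {0, 1, 2}" by auto
    then show "UNIV = {v 0, v 1, v 2}" using v unfolding bij_betw_def by auto
    show "B_simple (v 0) (v 1) = - 1 / 2" by (intro B_simple_of_m m_of_edge) (simp add: graph)
    show "B_simple (v 1) (v 2) = - sqrt 3 / 2" by (intro B_simple_of_m m_of_edge) (simp add: graph)
    show "B_simple (v 0) (v 2) = 0"
      using ne by (intro B_simple_of_m m_of_non_edge) (auto simp: graph doubleton_eq_iff)
  qed (fact ne)+
  show ?thesis by (rule futuristic)
qed

lemma futuristic_A_tilde: assumes type_A_tilde shows futuristic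
proof -
  obtain n v where n: "n \<ge> (2::nat)" and v: "bij_betw v {..<n} UNIV"
    and graph: "n = 2 \<and> coxeter_graph = {({v 0, v 1}, \<infinity>)} \<or>
      n \<ge> 3 \<and> coxeter_graph = {({v k, v (Suc k mod n)}, 3) | k. k < n}"
    using assms unfolding type_A_tilde_def
  proof (elim disjE exE conjE)
    fix v assume "bij_betw v {..<2::nat} UNIV" "coxeter_graph = {({v 0, v 1}, \<infinity>)}"
    then show thesis by (intro that[of 2 v]) blast+
  next
    fix n v assume "n \<ge> 3" "bij_betw v {..<n::nat} UNIV"
      "coxeter_graph = {({v k, v (Suc k mod n)}, 3) | k. k < n}"
    then show thesis by (intro that[of n v] disjI2 conjI) linarith+
  qed
  interpret crystallographic_coxeter_system W s
    by (rule crystallographic) (use graph in auto)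
  define node where "node k = v (nat (k mod int n))" for k
  have mod_range: "0 \<le> k mod int n" "nat (k mod int n) < n" for k
    using n by (simp_all add: nat_less_iff)
  have node_eq: "node k = node l \<longleftrightarrow> k mod int n = l mod int n" for k l
  proof -
    have "node k = node l \<longleftrightarrow> nat (k mod int n) = nat (l mod int n)"
      unfolding node_def using bij_betw_imp_inj_on[OF v] mod_range by (simp add: inj_on_eq_iff)
    then show ?thesis using mod_range(1)[of k] mod_range(1)[of l] by (simp add: eq_nat_nat_iff)
  qed
  have node_surj: "\<exists>k. node k = i" for i
  proof -
    obtain j where "j < n" "v j = i" using v unfolding bij_betw_def by (metis UNIV_I imageE lessThan_iff)
    then have "node (int j) = i" by (simp add: node_def)
    then show ?thesis by blast
  qed
  have card: "card (UNIV :: 'i set) = n" using bij_betw_same_card[OF v] by simp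
  have node_add: "node (k + d) = node (l + d)" if "node k = node l" for k l d
    using that unfolding node_eq by (metis mod_add_left_eq)
  have node_Suc: "node (k + 1) \<noteq> node k" for k
  proof
    assume "node (k + 1) = node k"
    then have "int n dvd 1" unfolding node_eq by (simp add: mod_eq_dvd_iff)
    then show False using n by simp
  qed
  have B: "- 2 * B_simple (node k) i = of_bool (node (k + 1) = i) + of_bool (node (k - 1) = i)"
    if ne: "node k \<noteq> i" for k i
    using graph
  proof (elim disjE conjE)
    \<comment> \<open>Both neighbours of \<open>k\<close> lie over the same node; this double count
      matches the pairing -1 of the label \<open>\<infinity>\<close>.\<close>
    assume n2: "n = 2" and graph2: "coxeter_graph = {({v 0, v 1}, \<infinity>)}"
    have two: "node l = v 0 \<and> node (l + 1) = v 1 \<and> node (l - 1) = v 1 \<or> node l = v 1 \<and> node (l + 1) = v 0 \<and> node (l - 1) = v 0" for l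
    proof -
      have "l mod 2 = 0 \<and> (l + 1) mod 2 = 1 \<and> (l - 1) mod 2 = 1 \<or>
        l mod 2 = 1 \<and> (l + 1) mod 2 = 0 \<and> (l - 1) mod 2 = 0" by presburger
      then show ?thesis by (auto simp: node_def n2)
    qed
    obtain l where l: "node l = i" using node_surj by blast
    have i: "node (k + 1) = i" "node (k - 1) = i" using two[of k] two[of l] l ne by auto
    have "({node k, i}, \<infinity>) \<in> coxeter_graph" using two[of k] i unfolding graph2 by auto
    then have "B_simple (node k) i = - 1" by (intro B_simple_of_m m_of_edge)
    then show ?thesis using i by simp
  next
    assume n3: "n \<ge> 3" and graph3: "coxeter_graph = {({v k, v (Suc k mod n)}, 3) | k. k < n}"
    have edge: "({node l, node (l + 1)}, 3) \<in> coxeter_graph" for l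
    proof -
      have "node l = v (nat (l mod int n))" by (simp add: node_def)
      moreover have "node (l + 1) = v (Suc (nat (l mod int n)) mod n)"
      proof -
        have "(l + 1) mod int n = int (Suc (nat (l mod int n)) mod n)"
          using mod_range(1)[of l] by (simp add: zmod_int mod_add_right_eq add.commute)
        then show ?thesis by (simp add: node_def)
      qed
      ultimately show ?thesis using mod_range(2)[of l] unfolding graph3 by auto
    qed
    have edge_cases: "\<exists>l. e = {node l, node (l + 1)}" if edge: "(e, x) \<in> coxeter_graph" for e x
    proof -
      obtain j where j: "j < n" "e = {v j, v (Suc j mod n)}" using edge unfolding graph3 by auto
      have "node (int j) = v j" "node (int j + 1) = v (Suc j mod n)"
        using j(1) by (auto simp: node_def nat_mod_distrib nat_add_distrib)
      then show ?thesis using j(2) by metis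
    qed
    have pm: "node (k + 1) \<noteq> node (k - 1)"
    proof
      assume "node (k + 1) = node (k - 1)"
      then have "int n dvd 2" unfolding node_eq by (simp add: mod_eq_dvd_iff)
      then show False using n3 zdvd_imp_le[of "int n" 2] by simp
    qed
    consider "i = node (k + 1)" | "i = node (k - 1)" | "i \<noteq> node (k + 1)" "i \<noteq> node (k - 1)" by blast
    then show ?thesis
    proof cases
      case 1
      then have "B_simple (node k) i = - 1 / 2" using edge by (intro B_simple_of_m m_of_edge) simp
      then show ?thesis using 1 pm by simp
    next
      case 2
      then have "B_simple i (node k) = - 1 / 2"
        using edge[of "k - 1"] by (intro B_simple_of_m m_of_edge) simp
      then show ?thesis using 2 pm by (simp add: B_simple_sym[of "node k" "node (k - 1)"])
    next
      case 3
      have "({node k, i}, x) \<notin> coxeter_graph" for x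
      proof
        assume "({node k, i}, x) \<in> coxeter_graph"
        then obtain l where "{node k, i} = {node l, node (l + 1)}" using edge_cases by blast
        then consider "node k = node l" "i = node (l + 1)" | "i = node l" "node k = node (l + 1)"
          by (auto simp: doubleton_eq_iff)
        then show False
        proof cases
          case 1
          then show ?thesis using 3 node_add by metis
        next
          case 2
          then show ?thesis using 3 node_add[of k "l + 1" "- 1"] by simp
        qed
      qed
      then have "B_simple (node k) i = 0" using ne by (intro B_simple_of_m m_of_non_edge)
      then show ?thesis using 3 by auto
    qed
  qed
  interpret cyclic_cover W s node "\<lambda>_. 1"
  proof
    show "\<exists>p. node p \<notin> {i, j}" if "m i j \<noteq> \<infinity>" for i j
    proof -
      \<comment> \<open>Two indices exhaust the index set only for \<open>n = 2\<close>, where their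
        label is infinite.\<close>
      have "{i, j} \<noteq> UNIV"
      proof
        assume U: "{i, j} = UNIV"
        have "card {i, j} = n" unfolding U by (rule card)
        moreover have "card {i, j} \<le> 2" by (simp add: card_insert_if)
        ultimately have n2: "n = 2" using n by simp
        have "{..<n} = {0, 1}" using n2 by auto
        then have "{v 0, v 1} = {i, j}" using bij_betw_imp_surj_on[OF v] U by simp
        then have "({i, j}, \<infinity>) \<in> coxeter_graph" using graph n2 by auto
        then have "m i j = \<infinity>" by (rule m_of_edge)
        then show False using that by simp
      qed
      then show ?thesis using node_surj by (metis UNIV_eq_I)
    qed
  qed (use node_surj node_Suc B in auto)
  show ?thesis by (rule futuristic)
qed

lemma futuristic_C_tilde: assumes type_C_tilde shows futuristic
proof -
  obtain n v where n: "n \<ge> (3::nat)" and v: "bij_betw v {..<n} UNIV"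
    and graph: "coxeter_graph =
          {({v k, v (Suc k)}, if k = 0 \<or> k = n - 2 then 4 else 3) | k. Suc k < n}"
    using assms unfolding type_C_tilde_def by blast
  interpret crystallographic_coxeter_system W s
    by (rule crystallographic) (auto simp: graph split: if_splits)
  define M where "M = int n - 1"
  have M: "M \<ge> 2" using n by (simp add: M_def)
  \<comment> \<open>The distance from \<open>k\<close> to the nearest multiple of
    \<open>2 * M\<close>: a zigzag along the path from 0 to \<open>M\<close> and back.\<close>
  define f where "f k = min (k mod (2 * M)) (2 * M - k mod (2 * M))" for k
  define node where "node k = v (nat (f k))" for k
  \<comment> \<open>In affine type C the simple roots at the two ends are longer than the others by
    the factor \<open>sqrt 2\<close>.\<close>
  define c where "c i = (if i = v 0 \<or> i = v (n - 1) then sqrt 2 else 1)" for i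
  have f_range: "0 \<le> f k" "f k \<le> M" for k
  proof -
    have "k mod (2 * M) \<ge> 0" "k mod (2 * M) < 2 * M" using M by simp_all
    then show "0 \<le> f k" "f k \<le> M" unfolding f_def by linarith+
  qed
  have f_next: "f k = 0 \<and> f (k + 1) = 1 \<and> f (k - 1) = 1 \<or>
      f k = M \<and> f (k + 1) = M - 1 \<and> f (k - 1) = M - 1 \<or>
      0 < f k \<and> f k < M \<and> (f (k + 1) = f k + 1 \<and> f (k - 1) = f k - 1 \<or>
        f (k + 1) = f k - 1 \<and> f (k - 1) = f k + 1)" for k
  proof -
    have M2: "2 * M > 0" using M by simp
    have succ: "(k + 1) mod (2 * M) = (if k mod (2 * M) = 2 * M - 1 then 0 else k mod (2 * M) + 1)"
      using mod_pred[OF M2, of "k + 1"] pos_mod_bound[OF M2, of "k + 1"] pos_mod_sign[OF M2, of "k + 1"]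
      by (auto split: if_splits)
    define r where "r = k mod (2 * M)"
    have "0 \<le> r" "r < 2 * M" using M2 by (simp_all add: r_def)
    then consider "r = 0" | "0 < r" "r < M" | "r = M" | "M < r" "r < 2 * M" by linarith
    then show ?thesis
      unfolding f_def succ mod_pred[OF M2] r_def[symmetric] using M by cases (auto simp: min_def)
  qed
  have v_inj: "v i = v j \<longleftrightarrow> i = j" if "i < n" "j < n" for i j
    using v that unfolding bij_betw_def inj_on_def by auto
  have v_nat: "v (nat a) = v (nat b) \<longleftrightarrow> a = b" if "0 \<le> a" "a \<le> M" "0 \<le> b" "b \<le> M" for a b
    using v_inj[of "nat a" "nat b"] that by (auto simp: M_def nat_less_iff)
  have v_surj: "\<exists>a. 0 \<le> a \<and> a \<le> M \<and> i = v (nat a)" for i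
  proof -
    obtain j where "j < n" "v j = i" using v unfolding bij_betw_def by (metis UNIV_I imageE lessThan_iff)
    then show ?thesis by (intro exI[of _ "int j"]) (auto simp: M_def)
  qed
  have c_v: "c (v (nat a)) = (if a = 0 \<or> a = M then sqrt 2 else 1)" if "0 \<le> a" "a \<le> M" for a
    using v_nat[of a 0] v_nat[of a M] that M by (auto simp: c_def M_def nat_diff_distrib)
  have B_next: "B_simple (v (nat a)) (v (nat (a + 1))) = (if a = 0 \<or> a = M - 1 then - sqrt 2 / 2 else - 1 / 2)"
    if "0 \<le> a" "a < M" for a
  proof -
    have a: "nat (a + 1) = Suc (nat a)" "Suc (nat a) < n" "nat a = 0 \<longleftrightarrow> a = 0" "nat a = n - 2 \<longleftrightarrow> a = M - 1"
      using that n by (auto simp: M_def)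
    have "({v (nat a), v (Suc (nat a))}, if nat a = 0 \<or> nat a = n - 2 then 4 else 3) \<in> coxeter_graph"
      unfolding graph using a(2) by blast
    from m_of_edge[OF this] show ?thesis unfolding a by (auto simp: B_simple_of_m)
  qed
  have B_far: "B_simple (v (nat a)) (v (nat b)) = 0"
    if "0 \<le> a" "a \<le> M" "0 \<le> b" "b \<le> M" "a \<noteq> b" "b \<noteq> a + 1" "a \<noteq> b + 1" for a b
  proof (intro B_simple_of_m m_of_non_edge notI)
    show False if "v (nat a) = v (nat b)" using v_nat[of a b] that \<open>a \<noteq> b\<close> \<open>0 \<le> a\<close> \<open>a \<le> M\<close> \<open>0 \<le> b\<close> \<open>b \<le> M\<close> by simp
    fix l assume "({v (nat a), v (nat b)}, l) \<in> coxeter_graph"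
    then obtain k where k: "Suc k < n" "{v (nat a), v (nat b)} = {v k, v (Suc k)}" unfolding graph by blast
    then have "nat a = k \<and> nat b = Suc k \<or> nat a = Suc k \<and> nat b = k"
      using v_inj[of "nat a" k] v_inj[of "nat b" k] v_inj[of "nat a" "Suc k"] v_inj[of "nat b" "Suc k"] that
      by (auto simp: doubleton_eq_iff M_def nat_less_iff)
    then show False using that by auto
  qed
  interpret cyclic_cover W s node c
  proof
    show "\<exists>k. node k = i" for i
    proof -
      obtain a where a: "0 \<le> a" "a \<le> M" "i = v (nat a)" using v_surj by blast
      then have "f a = a" using M by (simp add: f_def mod_pos_pos_trivial)
      then have "node a = i" using a by (simp add: node_def)
      then show ?thesis by blast
    qed
    show "0 < c i" for i by (simp add: c_def)
    show "node (k + 1) \<noteq> node k" for k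
      using f_next[of k] M v_nat[OF f_range[of "k + 1"] f_range[of k]] unfolding node_def by auto
    show "- 2 * c (node k) * B_simple (node k) i =
        c i * (of_bool (node (k + 1) = i) + of_bool (node (k - 1) = i))" if ne: "node k \<noteq> i" for k i
    proof -
      obtain b where b: "0 \<le> b" "b \<le> M" "i = v (nat b)" using v_surj by blast
      define a where "a = f k"
      have a: "0 \<le> a" "a \<le> M" "node k = v (nat a)" using f_range by (auto simp: a_def node_def)
      have eqs: "node (k + 1) = i \<longleftrightarrow> f (k + 1) = b" "node (k - 1) = i \<longleftrightarrow> f (k - 1) = b" "a \<noteq> b"
        using v_nat[OF f_range[of "k + 1"] b(1,2)] v_nat[OF f_range[of "k - 1"] b(1,2)] ne
        by (auto simp: node_def b(3) a_def)
      note next_k = f_next[of k, folded a_def]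
      define N where "N = of_bool (f (k + 1) = b) + (of_bool (f (k - 1) = b) :: real)"
      have goal: ?thesis if "- 2 * c (v (nat a)) * B_simple (v (nat a)) (v (nat b)) = c (v (nat b)) * N"
        using that unfolding N_def eqs a(3) b(3)[symmetric] .
      consider "b = a + 1" | "a = b + 1" | "b \<noteq> a + 1" "a \<noteq> b + 1" by blast
      then show ?thesis
      proof cases
        case 1
        \<comment> \<open>At a turning point of the zigzag both neighbours lie over the same node;
          the weights balance this factor 2.\<close>
        have N: "N = (if a = 0 then 2 else 1)" using next_k 1 a(1) b(2) by (auto simp: N_def)
        have "a < M" using 1 b(2) by simp
        note B = B_next[OF a(1) this, folded 1]
        consider "a = 0" | "a = M - 1" "a \<noteq> 0" | "0 < a" "a < M - 1" using a(1) \<open>a < M\<close> by linarith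
        then have "- 2 * c (v (nat a)) * B_simple (v (nat a)) (v (nat b)) = c (v (nat b)) * N"
          unfolding N B c_v[OF a(1,2)] c_v[OF b(1,2)] using M 1 by cases auto
        then show ?thesis by (rule goal)
      next
        case 2
        have N: "N = (if a = M then 2 else 1)" using next_k 2 a(2) b(1) by (auto simp: N_def)
        have "b < M" using 2 a(2) by simp
        note B = B_next[OF b(1) this, folded 2]
        consider "b = 0" | "b = M - 1" "b \<noteq> 0" | "0 < b" "b < M - 1" using b(1) \<open>b < M\<close> by linarith
        then have "- 2 * c (v (nat a)) * B_simple (v (nat a)) (v (nat b)) = c (v (nat b)) * N"
          unfolding N B_simple_sym[of "v (nat a)"] B c_v[OF a(1,2)] c_v[OF b(1,2)]
          using M 2 by cases auto
        then show ?thesis by (rule goal)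
      next
        case 3
        have "N = 0" using next_k 3 by (auto simp: N_def)
        then show ?thesis by (intro goal) (use B_far[OF a(1,2) b(1,2) eqs(3) 3] in simp)
      qed
    qed
    show "\<exists>p. node p \<notin> {i, j}" for i j
    proof -
      have "card {i, j} \<le> 2" by (simp add: card_insert_if)
      then have "card {i, j} < card (UNIV :: 'i set)" using bij_betw_same_card[OF v] n by simp
      then have "{i, j} \<noteq> UNIV" by auto
      then show ?thesis using \<open>\<And>i. \<exists>k. node k = i\<close> by (metis UNIV_eq_I)
    qed
  qed
  show ?thesis by (rule futuristic)
qed

end

theorem theorem1p15:
  fixes W :: "('a, 'b) monoid_scheme" and s :: "'i::finite \<Rightarrow> 'a"
  assumes "coxeter_system W s"
    and "coxeter_system.type_A_tilde W s \<or> coxeter_system.type_C_tilde W s \<or>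
         coxeter_system.type_G2_tilde W s"
  shows "coxeter_system.futuristic W s"
proof -
  interpret coxeter_system W s by (rule assms(1))
  show ?thesis
    using assms(2) futuristic_A_tilde futuristic_C_tilde futuristic_G2_tilde by blast
qed

end
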